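(* Every $2$-Riemannian manifold $(M,g)$ of dimension $2$ is locally flat.
   Context: Manifolds and maps are $C^\infty$; $\mathcal{X}(M)$ denotes the $C^\infty$ vector fields on $M$. A $2$-inner product on a real vector space $V$ is a map $g:V\times V\times V\to\mathbb{R}$, written $g(u,v/w)$, such that for all $u,u',v,w\in V$, $\alpha\in\mathbb{R}$: (1) $g(u,u/v)\ge 0$, and $g(u,u/v)=0$ iff $u,v$ are linearly dependent; (2) $g(u,u/v)=g(v,v/u)$; (3) $g(u,v/w)=g(v,u/w)$; (4) $g(\alpha u+u',v/w)=\alpha g(u,v/w)+g(u',v/w)$. A $2$-Riemannian metric on $M$ is an assignment $g$ of a $2$-inner product $g_p$ to each $T_pM$ such that $p\mapsto g_p(X(p),Y(p)/Z(p))$ is $C^\infty$ for all $X,Y,Z\in\mathcal{X}(M)$; then $(M,g)$ is a $2$-Riemannian manifold. A $2$-isometry between $2$-Riemannian manifolds $(M,g)$ and $(\overline M,\overline g)$ is a diffeomorphism $h:M\to\overline M$ with $\overline g_{h(p)}(Dh_p(u),Dh_p(v)/Dh_p(w))=g_p(u,v/w)$ for all $p\in M$, $u,v,w\in T_pM$. $(M,g)$ is locally $2$-isometric to $(\overline M,\overline g)$ if for every $p\in M$ there are an open neighborhood $U$ of $p$ in $M$ and an open set $\overline U\subset\overline M$ such that $(U,g)$ and $(\overline U,\overline g)$ are $2$-isometric (there is a $2$-isometry between them). $g^{st}$ is the $2$-Riemannian metric on $\mathbb{R}^n$ given by $g^{st}_p(u,v/w)=\langle u,v\rangle\langle w,w\rangle-\langle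 u,w\rangle\langle v,w\rangle$, with $\langle\cdot,\cdot\rangle$ the Euclidean inner product. A $2$-Riemannian manifold $(M,g)$ of dimension $n$ is locally flat if it is locally $2$-isometric to $(\mathbb{R}^n,g^{st})$. *)

theory Defs
  imports "HOL-Analysis.Analysis" "HOL-Library.Function_Algebras"
begin

text \<open>Functions into a real vector space form a real vector space pointwise. This provides the
  linear structure on tangent spaces below.\<close>

instantiation "fun" :: (type, real_vector) real_vector
begin

definition scaleR_fun :: "real \<Rightarrow> ('a \<Rightarrow> 'b) \<Rightarrow> 'a \<Rightarrow> 'b"
  where "scaleR_fun r f = (\<lambda>x. r *\<^sub>R f x)"

instance
  by standard (auto simp: scaleR_fun_def plus_fun_def algebra_simps)

end

lemma scaleR_fun_apply [simp]: "(r *\<^sub>R f) x = r *\<^sub>R f x"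
  by (simp add: scaleR_fun_def)


subsection \<open>Smoothness in Euclidean space\<close>

text \<open>Intended for open sets \<open>S\<close> of a finite-dimensional space: \<open>f\<close> is \<open>C\<^sup>k\<close> on \<open>S\<close> iff all
  its iterated directional derivatives up to order \<open>k\<close> exist and are continuous on \<open>S\<close>.\<close>

primrec Ck_on :: "nat \<Rightarrow> 'a::real_normed_vector set \<Rightarrow> ('a \<Rightarrow> 'b::real_normed_vector) \<Rightarrow> bool" where
  "Ck_on 0 S f \<longleftrightarrow> continuous_on S f"
| "Ck_on (Suc k) S f \<longleftrightarrow>
     (\<forall>x\<in>S. f differentiable (at x)) \<and> (\<forall>v. Ck_on k S (\<lambda>x. frechet_derivative f (at x) v))"

definition smooth_on :: "'a::real_normed_vector set \<Rightarrow> ('a \<Rightarrow> 'b::real_normed_vector) \<Rightarrow> bool"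
  where "smooth_on S f \<longleftrightarrow> (\<forall>k. Ck_on k S f)"


subsection \<open>Smooth manifolds\<close>

text \<open>A chart is a pair of an open domain \<open>U\<close> and a map \<open>\<phi>\<close>; the values of \<open>\<phi>\<close> outside \<open>U\<close> are
  irrelevant, and the inverse chart on \<open>\<phi> ` U\<close> is \<open>inv_into U \<phi>\<close>. The dimension is \<open>CARD('n)\<close>. The
  atlas is not required to be maximal: all notions below depend only on the smooth structure that
  it generates.\<close>

type_synonym ('a, 'n) chart = "'a set \<times> ('a \<Rightarrow> real ^ 'n)"

record ('a, 'n) manifold =
  topo :: "'a topology"
  atlas :: "('a, 'n) chart set"

abbreviation pts :: "('a, 'n) manifold \<Rightarrow> 'a set"
  where "pts M \<equiv> topspace (topo M)"

definition is_chart :: "'a topology \<Rightarrow> ('a, 'n::finite) chart \<Rightarrow> bool" where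
  "is_chart X = (\<lambda>(U, \<phi>). openin X U \<and> open (\<phi> ` U) \<and>
     homeomorphic_map (subtopology X U) (top_of_set (\<phi> ` U)) \<phi>)"

definition smooth_manifold :: "('a, 'n::finite) manifold \<Rightarrow> bool" where
  "smooth_manifold M \<longleftrightarrow>
     Hausdorff_space (topo M) \<and> second_countable (topo M) \<and>
     (\<forall>c\<in>atlas M. is_chart (topo M) c) \<and>
     (\<Union>(U, \<phi>)\<in>atlas M. U) = pts M \<and>
     (\<forall>(U, \<phi>)\<in>atlas M. \<forall>(V, \<psi>)\<in>atlas M. smooth_on (\<phi> ` (U \<inter> V)) (\<psi> \<circ> inv_into U \<phi>))"

definition open_submanifold :: "('a, 'n) manifold \<Rightarrow> 'a set \<Rightarrow> ('a, 'n) manifold" where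
  "open_submanifold M W =
     \<lparr>topo = subtopology (topo M) W, atlas = (\<lambda>(U, \<phi>). (U \<inter> W, \<phi>)) ` atlas M\<rparr>"

definition euclidean_manifold :: "(real ^ 'n, 'n::finite) manifold" where
  "euclidean_manifold = \<lparr>topo = euclidean, atlas = {(UNIV, id)}\<rparr>"

definition smooth_fun_on :: "('a, 'n::finite) manifold \<Rightarrow> 'a set \<Rightarrow> ('a \<Rightarrow> real) \<Rightarrow> bool" where
  "smooth_fun_on M W f \<longleftrightarrow>
     (\<forall>(U, \<phi>)\<in>atlas M. smooth_on (\<phi> ` (U \<inter> W)) (f \<circ> inv_into U \<phi>))"

definition smooth_map ::
    "('a, 'n::finite) manifold \<Rightarrow> ('b, 'm::finite) manifold \<Rightarrow> ('a \<Rightarrow> 'b) \<Rightarrow> bool" where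
  "smooth_map M N h \<longleftrightarrow> continuous_map (topo M) (topo N) h \<and>
     (\<forall>(U, \<phi>)\<in>atlas M. \<forall>(V, \<psi>)\<in>atlas N. smooth_on (\<phi> ` (U \<inter> h -` V)) (\<psi> \<circ> h \<circ> inv_into U \<phi>))"

definition diffeomorphism ::
    "('a, 'n::finite) manifold \<Rightarrow> ('b, 'm::finite) manifold \<Rightarrow> ('a \<Rightarrow> 'b) \<Rightarrow> bool" where
  "diffeomorphism M N h \<longleftrightarrow> smooth_map M N h \<and>
     (\<exists>k. smooth_map N M k \<and> (\<forall>p\<in>pts M. k (h p) = p) \<and> (\<forall>q\<in>pts N. h (k q) = q))"


subsection \<open>Tangent vectors and vector fields\<close>

text \<open>Tangent vectors at \<open>p\<close> are the derivations at \<open>p\<close> of the algebra of functions that are smooth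
  near \<open>p\<close>, normalised to be \<open>0\<close> on all other functions. Such a derivation depends only on the germ
  of its argument: if \<open>f\<close> vanishes near \<open>p\<close>, then \<open>f = f * \<chi>\<close> for the indicator function \<open>\<chi>\<close> of the
  complement of a neighbourhood of \<open>p\<close>, and \<open>f\<close> and \<open>\<chi>\<close> both vanish at \<open>p\<close>.\<close>

definition smooth_at :: "('a, 'n::finite) manifold \<Rightarrow> 'a \<Rightarrow> ('a \<Rightarrow> real) \<Rightarrow> bool" where
  "smooth_at M p f \<longleftrightarrow> (\<exists>W. openin (topo M) W \<and> p \<in> W \<and> smooth_fun_on M W f)"

type_synonym 'a tangent = "('a \<Rightarrow> real) \<Rightarrow> real"

definition tangent_space :: "('a, 'n::finite) manifold \<Rightarrow> 'a \<Rightarrow> 'a tangent set" where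
  "tangent_space M p = {u.
     (\<forall>f. \<not> smooth_at M p f \<longrightarrow> u f = 0) \<and>
     (\<forall>a f f'. smooth_at M p f \<longrightarrow> smooth_at M p f' \<longrightarrow>
        u (\<lambda>x. a * f x + f' x) = a * u f + u f' \<and>
        u (\<lambda>x. f x * f' x) = u f * f' p + f p * u f')}"

lemma subspace_tangent_space: "subspace (tangent_space M p)"
  by (auto simp: subspace_def tangent_space_def algebra_simps)

definition vector_field :: "('a, 'n::finite) manifold \<Rightarrow> ('a \<Rightarrow> 'a tangent) \<Rightarrow> bool" where
  "vector_field M X \<longleftrightarrow> (\<forall>p\<in>pts M. X p \<in> tangent_space M p) \<and>
     (\<forall>W f. openin (topo M) W \<longrightarrow> smooth_fun_on M W f \<longrightarrow> smooth_fun_on M W (\<lambda>p. X p f))"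

definition differential ::
    "('a, 'n::finite) manifold \<Rightarrow> ('b, 'm::finite) manifold \<Rightarrow> ('a \<Rightarrow> 'b) \<Rightarrow> 'a \<Rightarrow> 'a tangent \<Rightarrow> 'b tangent"
  where "differential M N h p u = (\<lambda>f. if smooth_at N (h p) f then u (f \<circ> h) else 0)"


subsection \<open>2-Riemannian manifolds\<close>

text \<open>Linear dependence of the pair \<open>(u, v)\<close>; the library's \<open>dependent {u, v}\<close> concerns a set and
  is false if \<open>u = v \<noteq> 0\<close>.\<close>

definition lin_dep :: "'v::real_vector \<Rightarrow> 'v \<Rightarrow> bool" where
  "lin_dep u v \<longleftrightarrow> (\<exists>a b. (a \<noteq> 0 \<or> b \<noteq> 0) \<and> a *\<^sub>R u + b *\<^sub>R v = 0)"

text \<open>\<open>g u v w\<close> stands for \<open>g(u, v / w)\<close>; \<open>V\<close> is a linear subspace.\<close>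

definition two_inner_product_on :: "'v::real_vector set \<Rightarrow> ('v \<Rightarrow> 'v \<Rightarrow> 'v \<Rightarrow> real) \<Rightarrow> bool" where
  "two_inner_product_on V g \<longleftrightarrow>
     (\<forall>u\<in>V. \<forall>v\<in>V. g u u v \<ge> 0 \<and> (g u u v = 0 \<longleftrightarrow> lin_dep u v)) \<and>
     (\<forall>u\<in>V. \<forall>v\<in>V. g u u v = g v v u) \<and>
     (\<forall>u\<in>V. \<forall>v\<in>V. \<forall>w\<in>V. g u v w = g v u w) \<and>
     (\<forall>u\<in>V. \<forall>u'\<in>V. \<forall>v\<in>V. \<forall>w\<in>V. \<forall>\<alpha>. g (\<alpha> *\<^sub>R u + u') v w = \<alpha> * g u v w + g u' v w)"

type_synonym 'a two_metric = "'a \<Rightarrow> 'a tangent \<Rightarrow> 'a tangent \<Rightarrow> 'a tangent \<Rightarrow> real"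

definition two_riemannian_metric :: "('a, 'n::finite) manifold \<Rightarrow> 'a two_metric \<Rightarrow> bool" where
  "two_riemannian_metric M g \<longleftrightarrow>
     (\<forall>p\<in>pts M. two_inner_product_on (tangent_space M p) (g p)) \<and>
     (\<forall>X Y Z. vector_field M X \<longrightarrow> vector_field M Y \<longrightarrow> vector_field M Z \<longrightarrow>
        smooth_fun_on M (pts M) (\<lambda>p. g p (X p) (Y p) (Z p)))"

definition two_riemannian_manifold :: "('a, 'n::finite) manifold \<Rightarrow> 'a two_metric \<Rightarrow> bool" where
  "two_riemannian_manifold M g \<longleftrightarrow> smooth_manifold M \<and> two_riemannian_metric M g"

definition two_isometry ::
    "('a, 'n::finite) manifold \<Rightarrow> 'a two_metric \<Rightarrow> ('b, 'm::finite) manifold \<Rightarrow> 'b two_metric \<Rightarrow>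
      ('a \<Rightarrow> 'b) \<Rightarrow> bool" where
  "two_isometry M g N g' h \<longleftrightarrow> diffeomorphism M N h \<and>
     (\<forall>p\<in>pts M. \<forall>u\<in>tangent_space M p. \<forall>v\<in>tangent_space M p. \<forall>w\<in>tangent_space M p.
        g' (h p) (differential M N h p u) (differential M N h p v) (differential M N h p w)
          = g p u v w)"

lemma Ck_on_subset: "Ck_on k S f \<Longrightarrow> T \<subseteq> S \<Longrightarrow> Ck_on k T f"
  by (induction k arbitrary: f) (auto intro: continuous_on_subset)

lemma Ck_on_cong:
  assumes "open S" "\<And>x. x \<in> S \<Longrightarrow> f x = f' x"
  shows "Ck_on k S f \<longleftrightarrow> Ck_on k S f'"
  using assms(2)
proof (induction k arbitrary: f f')
  case 0
  then show ?case by (auto cong: continuous_on_cong)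
next
  case (Suc k)
  have ev: "f x = f' x" if "x \<in> S" for x using Suc.prems that .
  have hd: "(f has_derivative D) (at x) \<longleftrightarrow> (f' has_derivative D) (at x)" if "x \<in> S" for x D
    using that ev assms(1) has_derivative_transform_within_open[of f D x UNIV S f']
      has_derivative_transform_within_open[of f' D x UNIV S f] by auto
  have "f differentiable (at x) \<longleftrightarrow> f' differentiable (at x)" if "x \<in> S" for x
    using hd[OF that] by (simp add: differentiable_def)
  moreover have "frechet_derivative f (at x) = frechet_derivative f' (at x)" if "x \<in> S" for x
    using hd[OF that] by (simp add: frechet_derivative_def)
  ultimately show ?case
    using Suc.IH[of "\<lambda>x. frechet_derivative f (at x) v" "\<lambda>x. frechet_derivative f' (at x) v" for v]
    by simp
qed

text \<open>The tangent spaces of an open submanifold literally coincide with those of the manifold, so a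
  2-Riemannian metric restricts without any identification.\<close>

lemma tangent_space_open_submanifold:
  assumes M: "smooth_manifold M" and W: "openin (topo M) W" and p: "p \<in> W"
  shows "tangent_space (open_submanifold M W) p = tangent_space M p"
proof -
  have eq: "smooth_fun_on (open_submanifold M W) T f \<longleftrightarrow> smooth_fun_on M T f"
    if T: "openin (topo M) T" "T \<subseteq> W" for T f
  proof -
    have "smooth_on (\<phi> ` (U \<inter> W \<inter> T)) (f \<circ> inv_into (U \<inter> W) \<phi>) \<longleftrightarrow>
          smooth_on (\<phi> ` (U \<inter> T)) (f \<circ> inv_into U \<phi>)" if c: "(U, \<phi>) \<in> atlas M" for U \<phi>
    proof -
      have ch: "openin (topo M) U" "open (\<phi> ` U)"
        "homeomorphic_map (subtopology (topo M) U) (top_of_set (\<phi> ` U)) \<phi>"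
        using M c by (auto simp: smooth_manifold_def is_chart_def)
      have inj: "inj_on \<phi> U"
        using homeomorphic_imp_injective_map[OF ch(3)] openin_subset[OF ch(1)]
        by (simp add: Int_absorb1)
      have "openin (subtopology (topo M) U) (U \<inter> T)"
        using T(1) by (auto simp: openin_subtopology)
      then have "openin (top_of_set (\<phi> ` U)) (\<phi> ` (U \<inter> T))"
        using homeomorphic_imp_open_map[OF ch(3)] by (simp add: open_map_def)
      then have op: "open (\<phi> ` (U \<inter> T))"
        using ch(2) openin_open_trans by blast
      have UT: "U \<inter> W \<inter> T = U \<inter> T" using T by auto
      have ff: "(f \<circ> inv_into (U \<inter> W) \<phi>) y = (f \<circ> inv_into U \<phi>) y" if y: "y \<in> \<phi> ` (U \<inter> T)" for y
      proof -
        obtain x where x: "y = \<phi> x" "x \<in> U" "x \<in> W" using y T by auto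
        have "inj_on \<phi> (U \<inter> W)" using inj inj_on_subset by blast
        then show ?thesis using x inj by simp
      qed
      show ?thesis
        unfolding UT smooth_on_def
        using Ck_on_cong[OF op, of "f \<circ> inv_into (U \<inter> W) \<phi>" "f \<circ> inv_into U \<phi>"] ff by blast
    qed
    then show ?thesis
      by (force simp: smooth_fun_on_def open_submanifold_def)
  qed
  have "smooth_at (open_submanifold M W) p f \<longleftrightarrow> smooth_at M p f" for f
  proof
    assume "smooth_at (open_submanifold M W) p f"
    then obtain T where T: "openin (subtopology (topo M) W) T" "p \<in> T"
      "smooth_fun_on (open_submanifold M W) T f"
      by (auto simp: smooth_at_def open_submanifold_def)
    then have "openin (topo M) T" "T \<subseteq> W" using W by (auto simp: openin_open_subtopology)
    with T eq show "smooth_at M p f" by (auto simp: smooth_at_def)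
  next
    assume "smooth_at M p f"
    then obtain T where T: "openin (topo M) T" "p \<in> T" "smooth_fun_on M T f"
      by (auto simp: smooth_at_def)
    have "smooth_fun_on M (T \<inter> W) f"
      using T(3) unfolding smooth_fun_on_def smooth_on_def
      by (fastforce intro: Ck_on_subset)
    moreover have "openin (topo M) (T \<inter> W)" using T W by blast
    ultimately have "smooth_fun_on (open_submanifold M W) (T \<inter> W) f" using eq by simp
    moreover have "openin (subtopology (topo M) W) (T \<inter> W)"
      using T by (auto simp: openin_subtopology)
    ultimately show "smooth_at (open_submanifold M W) p f"
      using T p by (auto simp: smooth_at_def open_submanifold_def)
  qed
  then show ?thesis by (simp add: tangent_space_def)
qed

definition locally_two_isometric ::
    "('a, 'n::finite) manifold \<Rightarrow> 'a two_metric \<Rightarrow> ('b, 'm::finite) manifold \<Rightarrow> 'b two_metric \<Rightarrow> bool" where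
  "locally_two_isometric M g N g' \<longleftrightarrow>
     (\<forall>p\<in>pts M. \<exists>U U' h. openin (topo M) U \<and> p \<in> U \<and> openin (topo N) U' \<and>
        two_isometry (open_submanifold M U) g (open_submanifold N U') g' h)"

text \<open>The Euclidean inner product on the tangent space of \<open>\<real>\<^sup>n\<close> at \<open>p\<close>: a derivation \<open>u\<close> is
  identified with the vector of its values on the coordinate functions.\<close>

definition tangent_vec :: "(real ^ 'n) tangent \<Rightarrow> real ^ 'n::finite" where
  "tangent_vec u = (\<chi> i. u (\<lambda>x. x $ i))"

definition g_st :: "(real ^ 'n::finite) two_metric" where
  "g_st p u v w =
     (let u = tangent_vec u; v = tangent_vec v; w = tangent_vec w
      in (u \<bullet> v) * (w \<bullet> w) - (u \<bullet> w) * (v \<bullet> w))"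

definition locally_flat :: "('a, 'n::finite) manifold \<Rightarrow> 'a two_metric \<Rightarrow> bool" where
  "locally_flat M g \<longleftrightarrow>
     locally_two_isometric M g (euclidean_manifold :: (real ^ 'n, 'n) manifold) g_st"

end

theory Submission
  imports Defs "HOL-Real_Asymp.Real_Asymp"
begin

text \<open>
  On a two-dimensional vector space a 2-inner product is a positive multiple \<open>c\<close> of
  \<open>det(u, w) det(v, w)\<close>: Cauchy-Schwarz makes \<open>w\<close> a null vector of \<open>g(\<cdot>, \<cdot>/w)\<close>, and the
  symmetry \<open>g(u, u/w) = g(w, w/u)\<close> makes the factor independent of \<open>w\<close>. Hence a 2-Riemannian
  surface only carries an area density \<open>s = sqrt c\<close>, and the chart map
  \<open>h(x, y) = (\<integral> s(t, y) dt from t = a to x, y)\<close>, whose Jacobian determinant is \<open>s\<close>, transforms the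
  metric into the standard one. Smoothness of \<open>c\<close> follows by evaluating the metric on coordinate
  fields multiplied by a bump function \<open>b\<close>, which gives \<open>b^4 c\<close>.
\<close>

subsection \<open>Calculus of smooth maps\<close>

text \<open>In the plane, Lagrange's identity turns \<open>g_st\<close> into
  \<open>det(u, w) det(v, w)\<close>, so a pullback multiplies it by the square of the Jacobian
  determinant. Being a 2-isometry is then, up to sign, the single scalar equation
  \<open>det Dh = sqrt c\<close>, and a map that keeps one coordinate has enough freedom to solve
  it. Two gaps separate charts from the abstract notions. Tangent vectors are derivations, which
  Hadamard's lemma identifies with directional derivatives in a chart. And smoothness of a metric is
  tested only on globally defined vector fields, whereas coordinate fields live on one chart domain;
  cutting them off is legitimate because compact sets in a Hausdorff space are closed. The
  antiderivative and the Hadamard coefficients are both written as integrals over the fixed interval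
  [0, 1], so one theorem on differentiation under the integral sign serves both.\<close>

lemma Ck_on_Suc_imp: "Ck_on (Suc k) S f \<Longrightarrow> Ck_on k S f"
proof (induction k arbitrary: f)
  case 0
  then show ?case
    by (auto intro!: continuous_at_imp_continuous_on differentiable_imp_continuous_within)
next
  case (Suc k)
  then show ?case by simp
qed

lemma Ck_on_mono: "Ck_on n S f \<Longrightarrow> k \<le> n \<Longrightarrow> Ck_on k S f"
  by (induction n) (auto simp: le_Suc_eq simp del: Ck_on.simps dest: Ck_on_Suc_imp)

lemma Ck_on_imp_continuous_on: "Ck_on k S f \<Longrightarrow> continuous_on S f"
  using Ck_on_mono[of k S f 0] by simp

lemma Ck_on_local:
  assumes "\<And>x. x \<in> S \<Longrightarrow> \<exists>T. open T \<and> x \<in> T \<and> Ck_on k T f"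
  shows "Ck_on k S f"
  using assms
proof (induction k arbitrary: f)
  case 0
  have "isCont f x" if "x \<in> S" for x
    using 0[OF that] by (auto simp: continuous_on_eq_continuous_at)
  then show ?case by (simp add: continuous_at_imp_continuous_on)
next
  case (Suc k)
  show ?case
    unfolding Ck_on.simps using Suc.prems by (fastforce intro!: Suc.IH)
qed

lemma Ck_on_const [simp]: "Ck_on k S (\<lambda>x. c)"
proof (induction k arbitrary: c)
  case (Suc k)
  have "frechet_derivative (\<lambda>x. c) (at x) = (\<lambda>v. 0)" for x :: 'a
    by (metis has_derivative_const frechet_derivative_at)
  then show ?case using Suc by simp
qed simp

text \<open>\<open>Ck_on\<close> is phrased with \<open>frechet_derivative\<close>; uniqueness of
  derivatives on the open set lets any explicit formula \<open>D\<close> replace it. Most smoothness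
  inductions below end with this rule.\<close>

lemma Ck_on_SucI:
  assumes "open S" "\<And>x. x \<in> S \<Longrightarrow> (f has_derivative D x) (at x)" "\<And>v. Ck_on k S (\<lambda>x. D x v)"
  shows "Ck_on (Suc k) S f"
proof -
  have "Ck_on k S (\<lambda>x. frechet_derivative f (at x) v)" for v
    using assms Ck_on_cong[OF assms(1), of "\<lambda>x. frechet_derivative f (at x) v" "\<lambda>x. D x v" k]
    by (metis frechet_derivative_at)
  then show ?thesis using assms(2) by (auto simp: differentiable_def)
qed

lemma Ck_on_SucD:
  assumes "Ck_on (Suc k) S f"
  shows "x \<in> S \<Longrightarrow> (f has_derivative frechet_derivative f (at x)) (at x)"
    and "Ck_on k S (\<lambda>x. frechet_derivative f (at x) v)"
  using assms by (auto simp: frechet_derivative_works)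

lemma Ck_on_bounded_linear:
  assumes L: "bounded_linear L" and "open S" "Ck_on k S f"
  shows "Ck_on k S (\<lambda>x. L (f x))"
  using assms(3)
proof (induction k arbitrary: f)
  case 0
  then show ?case using L by (auto intro: linear_continuous_on_compose simp: linear_conv_bounded_linear bounded_linear.continuous_on)
next
  case (Suc k)
  note D = Ck_on_SucD[OF Suc.prems]
  show ?case
    by (rule Ck_on_SucI[OF \<open>open S\<close> bounded_linear.has_derivative[OF L D(1)] Suc.IH[OF D(2)]])
qed

lemma Ck_on_add:
  assumes "open S" "Ck_on k S f" "Ck_on k S g"
  shows "Ck_on k S (\<lambda>x. f x + g x)"
  using assms(2,3)
proof (induction k arbitrary: f g)
  case 0
  then show ?case by (auto intro!: continuous_on_add)
next
  case (Suc k)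
  note f = Ck_on_SucD[OF Suc.prems(1)] and g = Ck_on_SucD[OF Suc.prems(2)]
  show ?case
    by (rule Ck_on_SucI[OF \<open>open S\<close> has_derivative_add[OF f(1) g(1)] Suc.IH[OF f(2) g(2)]])
qed

lemma Ck_on_bounded_bilinear:
  assumes B: "bounded_bilinear B" and "open S" "Ck_on k S f" "Ck_on k S g"
  shows "Ck_on k S (\<lambda>x. B (f x) (g x))"
  using assms(3,4)
proof (induction k arbitrary: f g)
  case 0
  then show ?case by (auto intro: bounded_bilinear.continuous_on[OF B])
next
  case (Suc k)
  note f = Ck_on_SucD[OF Suc.prems(1)] and g = Ck_on_SucD[OF Suc.prems(2)]
  note f' = Ck_on_Suc_imp[OF Suc.prems(1)] and g' = Ck_on_Suc_imp[OF Suc.prems(2)]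
  show ?case
    by (rule Ck_on_SucI[OF \<open>open S\<close> bounded_bilinear.FDERIV[OF B f(1) g(1)]])
       (assumption | intro Ck_on_add[OF \<open>open S\<close>] Suc.IH f(2) g(2) f' g')+
qed

lemmas Ck_on_mult = Ck_on_bounded_bilinear[OF bounded_bilinear_mult]
lemmas Ck_on_scaleR = Ck_on_bounded_bilinear[OF bounded_bilinear_scaleR]

lemma Ck_on_sum:
  assumes "open S" "\<And>i. i \<in> I \<Longrightarrow> Ck_on k S (f i)"
  shows "Ck_on k S (\<lambda>x. \<Sum>i\<in>I. f i x)"
  using assms(2) by (induction I rule: infinite_finite_induct) (auto intro: Ck_on_add assms(1))

text \<open>In the chain rule the direction \<open>g'(x) v\<close> varies with \<open>x\<close>,
  while \<open>Ck_on\<close> controls derivatives in fixed directions. Expanding it in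
  \<open>Basis\<close> leaves products of derivatives of \<open>g\<close> with functions
  \<open>f'(g x) b\<close>, which are composites again and fall under the induction hypothesis for
  generalised \<open>f\<close>.\<close>

lemma Ck_on_compose:
  fixes f :: "'b::euclidean_space \<Rightarrow> 'c::real_normed_vector" and g :: "'a::real_normed_vector \<Rightarrow> 'b"
  assumes S: "open S" and T: "open T" and gST: "g ` S \<subseteq> T" and "Ck_on k T f" "Ck_on k S g"
  shows "Ck_on k S (\<lambda>x. f (g x))"
  using assms(4,5)
proof (induction k arbitrary: f)
  case 0
  then show ?case using gST by (auto intro: continuous_on_compose2)
next
  case (Suc k)
  note f = Ck_on_SucD[OF Suc.prems(1)] and g = Ck_on_SucD[OF Suc.prems(2)]
  let ?D = "\<lambda>x v. \<Sum>b\<in>Basis. (frechet_derivative g (at x) v \<bullet> b) *\<^sub>R frechet_derivative f (at (g x)) b"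
  have D: "((\<lambda>x. f (g x)) has_derivative ?D x) (at x)" if x: "x \<in> S" for x
  proof -
    have gx: "g x \<in> T" using gST x by auto
    have l: "linear (frechet_derivative f (at (g x)))"
      using f(1)[OF gx] has_derivative_linear by blast
    have "frechet_derivative f (at (g x)) w = (\<Sum>b\<in>Basis. (w \<bullet> b) *\<^sub>R frechet_derivative f (at (g x)) b)" for w
    proof -
      have "frechet_derivative f (at (g x)) w = frechet_derivative f (at (g x)) (\<Sum>b\<in>Basis. (w \<bullet> b) *\<^sub>R b)"
        by (simp only: euclidean_representation)
      also have "\<dots> = (\<Sum>b\<in>Basis. (w \<bullet> b) *\<^sub>R frechet_derivative f (at (g x)) b)"
        by (simp only: linear_sum[OF l] linear_cmul[OF l])
      finally show ?thesis .
    qed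
    then have "(\<lambda>v. frechet_derivative f (at (g x)) (frechet_derivative g (at x) v)) = ?D x"
      by (intro ext)
    with has_derivative_compose[OF g(1)[OF x] f(1)[OF gx]] show ?thesis
      by (simp only:)
  qed
  have C: "Ck_on k S (\<lambda>x. ?D x v)" for v
  proof (rule Ck_on_sum[OF S], rule Ck_on_scaleR[OF S])
    fix b :: 'b
    show "Ck_on k S (\<lambda>x. frechet_derivative g (at x) v \<bullet> b)"
      by (rule Ck_on_bounded_linear[OF bounded_linear_inner_left S g(2)])
    show "Ck_on k S (\<lambda>x. frechet_derivative f (at (g x)) b)"
      by (rule Suc.IH[OF f(2) Ck_on_Suc_imp[OF Suc.prems(2)]])
  qed
  show ?case by (rule Ck_on_SucI[OF S D C])
qed

lemma Ck_on_linear: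
  assumes "bounded_linear f" "open S"
  shows "Ck_on k S f"
proof (cases k)
  case 0
  then show ?thesis using assms by (simp add: linear_continuous_on)
next
  case (Suc n)
  then show ?thesis
    using Ck_on_SucI[OF assms(2) bounded_linear_imp_has_derivative[OF assms(1)], of n] by simp
qed

text \<open>All real exponents are treated together because differentiation lowers the exponent by
  one. The instances used are the square root of the density, the reciprocal of the Jacobian and the
  inverse fourth power of a bump.\<close>

lemma Ck_on_powr: "Ck_on k {0<..} (\<lambda>x::real. x powr a)"
proof (induction k arbitrary: a)
  case 0
  then show ?case by (auto intro!: continuous_on_powr' continuous_on_id continuous_on_const)
next
  case (Suc k)
  have "((\<lambda>x. x powr a) has_derivative (\<lambda>v. (a * x powr (a - 1)) * v)) (at x)" if "x \<in> {0<..}" for x :: real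
    using that has_real_derivative_powr[of x a] by (auto simp: has_field_derivative_def)
  then show ?case
    by (rule Ck_on_SucI[rotated]) (auto intro!: Ck_on_mult Suc.IH)
qed

text \<open>The exponent \<open>a\<close> makes the family closed under differentiation, so that smoothness can be
  proved for all members at once.\<close>

definition flat_exp :: "real \<Rightarrow> real \<Rightarrow> real" where
  "flat_exp a x = (if x > 0 then x powr a * exp (- (1 / x)) else 0)"

lemma flat_exp_tendsto: "(flat_exp a \<longlongrightarrow> 0) (at 0)"
proof -
  have "((\<lambda>x. x powr a * exp (- (1 / x))) \<longlongrightarrow> 0) (at_right 0)" by real_asymp
  then have "(flat_exp a \<longlongrightarrow> 0) (at_right 0)"
    by (rule Lim_transform_eventually)
      (auto simp: flat_exp_def eventually_at_right_less intro: eventually_mono[OF eventually_at_right_less])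
  moreover have "(flat_exp a \<longlongrightarrow> 0) (at_left 0)"
    by (rule tendsto_eventually) (auto simp: flat_exp_def eventually_at_filter)
  ultimately show ?thesis by (simp add: filterlim_split_at)
qed

text \<open>Differentiating the power lowers the exponent by 1, differentiating \<open>-1/x\<close>
  inside the exponential lowers it by 2. At the origin the difference quotient is
  \<open>flat_exp (a - 1)\<close>, which tends to 0 for every exponent.\<close>

lemma flat_exp_deriv:
  "(flat_exp a has_real_derivative a * flat_exp (a - 1) x + flat_exp (a - 2) x) (at x)"
proof -
  consider "x > 0" | "x < 0" | "x = 0" by linarith
  then show ?thesis
  proof cases
    case 1
    have "((\<lambda>x. x powr a * exp (- (1 / x))) has_real_derivative
            a * flat_exp (a - 1) x + flat_exp (a - 2) x) (at x)"
      using 1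
      apply (auto intro!: derivative_eq_intros)
      apply (simp add: flat_exp_def powr_diff power2_eq_square field_simps)
      done
    then show ?thesis
      by (rule has_field_derivative_transform_within_open[where S = "{0<..}"])
        (use 1 in \<open>auto simp: flat_exp_def\<close>)
  next
    case 2
    have "((\<lambda>x. 0) has_real_derivative a * flat_exp (a - 1) x + flat_exp (a - 2) x) (at x)"
      using 2 by (auto simp: flat_exp_def)
    then show ?thesis
      by (rule has_field_derivative_transform_within_open[where S = "{..<0}"])
        (use 2 in \<open>auto simp: flat_exp_def\<close>)
  next
    case 3
    have "(flat_exp a y - flat_exp a 0) / (y - 0) = flat_exp (a - 1) y" for y
      by (auto simp: flat_exp_def powr_diff)
    then have "((\<lambda>y. (flat_exp a y - flat_exp a 0) / (y - 0)) \<longlongrightarrow> 0) (at 0)"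
      using flat_exp_tendsto[of "a - 1"] by simp
    then show ?thesis using 3
      by (simp add: has_field_derivative_iff flat_exp_def[of _ 0])
  qed
qed

lemma Ck_on_flat_exp: "Ck_on k UNIV (flat_exp a)"
proof (induction k arbitrary: a)
  case 0
  show ?case unfolding Ck_on.simps
    using flat_exp_deriv DERIV_isCont by (blast intro: continuous_at_imp_continuous_on)
next
  case (Suc k)
  have D: "(flat_exp a has_derivative (\<lambda>v. (a * flat_exp (a - 1) x + flat_exp (a - 2) x) * v)) (at x)" for x
    using flat_exp_deriv by (simp add: has_field_derivative_def)
  show ?case
    by (rule Ck_on_SucI[OF _ D]) (auto intro!: Ck_on_mult Ck_on_add Suc.IH)
qed

subsection \<open>Integrals along segments\<close>

text \<open>The affine map \<open>L x + d\<close> covers both segments from \<open>x\<close> to a fixed point (Hadamard's lemma)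
  and segments from \<open>x\<close> to a fixed line (antiderivatives in one variable).\<close>

lemma has_derivative_segment_integral:
  fixes f :: "'a::euclidean_space \<Rightarrow> real" and L :: "'a \<Rightarrow> 'a"
  assumes L: "bounded_linear L" and c: "continuous_on {0..1} c"
    and T: "open T" "convex T"
    and A: "\<And>x t. x \<in> T \<Longrightarrow> t \<in> {0..1} \<Longrightarrow> x + t *\<^sub>R (L x + d) \<in> S"
    and f: "Ck_on (Suc 0) S f" and x: "x \<in> T"
  shows "((\<lambda>x. integral {0..1} (\<lambda>t. c t * f (x + t *\<^sub>R (L x + d)))) has_derivative
     (\<lambda>v. integral {0..1} (\<lambda>t. c t * frechet_derivative f (at (x + t *\<^sub>R (L x + d))) v) +
        integral {0..1} (\<lambda>t. (c t * t) * frechet_derivative f (at (x + t *\<^sub>R (L x + d))) (L v)))) (at x)"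
proof -
  let ?A = "\<lambda>t x. x + t *\<^sub>R (L x + d)"
  let ?D = "\<lambda>x t v. c t * frechet_derivative f (at (?A t x)) (v + t *\<^sub>R L v)"
  note fd = Ck_on_SucD[OF f]
  have bl: "bounded_linear (frechet_derivative f (at (?A t x)))" if "x \<in> T" "t \<in> {0..1}" for x t
    using fd(1)[OF A[OF that]] has_derivative_bounded_linear by blast
  have D: "((\<lambda>x. c t * f (?A t x)) has_derivative ?D x t) (at x)" if "x \<in> T" "t \<in> {0..1}" for x t
  proof -
    have "(?A t has_derivative (\<lambda>v. v + t *\<^sub>R L v)) (at x)"
      by (auto intro!: derivative_eq_intros bounded_linear.has_derivative[OF L])
    from has_derivative_compose[OF this fd(1)[OF A[OF that]]] show ?thesis
      by (rule has_derivative_mult_right)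
  qed
  have bD: "bounded_linear (?D x t)" if "x \<in> T" "t \<in> {0..1}" for x t
    using D[OF that] has_derivative_bounded_linear by blast
  have Dv: "?D x t v = c t * frechet_derivative f (at (?A t x)) v +
      (c t * t) * frechet_derivative f (at (?A t x)) (L v)" if "x \<in> T" "t \<in> {0..1}" for x t v
    using bl[OF that] by (simp add: linear_add linear_cmul bounded_linear.linear algebra_simps)
  have cA: "continuous_on (T \<times> {0..1}) (\<lambda>(x, t). ?A t x)"
    unfolding case_prod_unfold
    by (intro continuous_on_add continuous_on_scaleR continuous_on_fst continuous_on_snd continuous_on_id
        continuous_on_const bounded_linear.continuous_on[OF L])
  have cF: "continuous_on (T \<times> {0..1}) (\<lambda>(x, t). g (?A t x))" if "continuous_on S g" for g :: "'a \<Rightarrow> real"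
    using continuous_on_compose2[OF that cA[unfolded case_prod_unfold]] A
    by (auto simp: case_prod_unfold image_subset_iff)
  have cc: "continuous_on (T \<times> {0..1}) (\<lambda>(x, t). c t)"
    unfolding case_prod_unfold
    by (rule continuous_on_compose2[OF c continuous_on_snd[OF continuous_on_id]]) auto
  have fd0: "continuous_on S (\<lambda>y. frechet_derivative f (at y) v)" for v
    using fd(2)[of v] by simp
  have cD: "continuous_on (T \<times> {0..1}) (\<lambda>(x, t). ?D x t v)" for v
  proof -
    have "continuous_on (T \<times> {0..1}) (\<lambda>(x, t). c t * frechet_derivative f (at (?A t x)) v +
      (c t * t) * frechet_derivative f (at (?A t x)) (L v))"
      using cF[OF fd0[of v]] cF[OF fd0[of "L v"]] cc
      unfolding case_prod_unfold
      by (intro continuous_on_add continuous_on_mult continuous_on_snd[OF continuous_on_id])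
    then show ?thesis
      by (rule continuous_on_eq) (auto simp: Dv)
  qed
  have slice: "continuous_on {0..1} (\<lambda>t. h x t)" if "continuous_on (T \<times> {0..1}) (\<lambda>(x, t). h x t)" "x \<in> T"
    for h :: "'a \<Rightarrow> real \<Rightarrow> 'c::topological_space" and x
    using continuous_on_compose2[OF that(1), of "{0..1}" "\<lambda>t. (x, t)"] that(2)
      continuous_on_Pair[OF continuous_on_const continuous_on_id, of "{0..1}" x]
    by (auto simp: image_subset_iff)
  \<comment> \<open>The Leibniz rule wants an operator-valued, jointly continuous derivative;
    bundling with \<open>Blinfun\<close> reduces its continuity to the basis directions.\<close>
  let ?B = "\<lambda>x t. Blinfun (?D x t)"
  have B: "blinfun_apply (?B x t) = ?D x t" if "x \<in> T" "t \<in> {0..1}" for x t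
    by (rule bounded_linear_Blinfun_apply[OF bD[OF that]])
  have cB: "continuous_on (T \<times> {0..1}) (\<lambda>(x, t). ?B x t)"
  proof (rule continuous_on_blinfun_componentwise)
    fix i :: 'a assume "i \<in> Basis"
    show "continuous_on (T \<times> {0..1}) (\<lambda>z. blinfun_apply (case z of (x, t) \<Rightarrow> ?B x t) i)"
      using cD[of i] by (rule continuous_on_eq) (auto simp: B)
  qed
  have cf: "continuous_on S f" using Ck_on_imp_continuous_on[OF f] .
  have cf': "continuous_on {0..1} (\<lambda>t. c t * f (?A t x))" if "x \<in> T" for x
    by (rule continuous_on_mult[OF c slice[OF cF[OF cf] that]])
  have D0: "((\<lambda>x. integral (cbox 0 1) (\<lambda>t. c t * f (?A t x))) has_derivative
      blinfun_apply (integral (cbox 0 1) (?B x))) (at x within T)"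
    using cf' cB
    by (intro leibniz_rule)
       (auto simp: B T x intro!: has_derivative_at_withinI[OF D] integrable_continuous_real)
  have "blinfun_apply (integral (cbox 0 1) (?B x)) v =
      integral {0..1} (\<lambda>t. c t * frechet_derivative f (at (?A t x)) v) +
        integral {0..1} (\<lambda>t. (c t * t) * frechet_derivative f (at (?A t x)) (L v))" (is "_ = ?I v") for v
  proof -
    have "?B x integrable_on {0..1}"
      by (rule integrable_continuous_real[OF slice[OF cB x]])
    then have "blinfun_apply (integral {0..1} (?B x)) v = integral {0..1} (\<lambda>t. blinfun_apply (?B x t) v)"
      by (rule blinfun_apply_integral)
    also have "\<dots> = integral {0..1} (\<lambda>t. c t * frechet_derivative f (at (?A t x)) v +
        (c t * t) * frechet_derivative f (at (?A t x)) (L v))"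
    proof (rule integral_cong)
      fix t :: real assume t: "t \<in> {0..1}"
      show "blinfun_apply (?B x t) v = c t * frechet_derivative f (at (?A t x)) v +
          (c t * t) * frechet_derivative f (at (?A t x)) (L v)"
        using B[OF x t] Dv[OF x t] by metis
    qed
    also have "\<dots> = integral {0..1} (\<lambda>t. c t * frechet_derivative f (at (?A t x)) v) +
        integral {0..1} (\<lambda>t. (c t * t) * frechet_derivative f (at (?A t x)) (L v))"
      by (intro integral_add integrable_continuous_real continuous_on_mult c continuous_on_id
          slice[OF cF[OF fd0] x])
    finally show ?thesis by simp
  qed
  then have "blinfun_apply (integral (cbox 0 1) (?B x)) = ?I" by (rule ext)
  then show ?thesis
    using D0 unfolding at_within_open[OF x T(1)] box_real by (simp only:)
qed

text \<open>The weight is generalised in the induction since each differentiation may turn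
  \<open>c t\<close> into \<open>c t * t\<close>. One order of differentiability is given up, as
  even continuity is drawn from the derivative formula; for smooth \<open>f\<close> nothing is
  lost.\<close>

lemma Ck_on_segment_integral:
  fixes f :: "'a::euclidean_space \<Rightarrow> real" and L :: "'a \<Rightarrow> 'a"
  assumes L: "bounded_linear L" and c: "continuous_on {0..1} c"
    and T: "open T" "convex T"
    and A: "\<And>x t. x \<in> T \<Longrightarrow> t \<in> {0..1} \<Longrightarrow> x + t *\<^sub>R (L x + d) \<in> S"
    and f: "Ck_on (Suc k) S f"
  shows "Ck_on k T (\<lambda>x. integral {0..1} (\<lambda>t. c t * f (x + t *\<^sub>R (L x + d))))"
  using f c
proof (induction k arbitrary: f c)
  case 0
  show ?case unfolding Ck_on.simps
    using has_derivative_segment_integral[OF L 0(2) T A 0(1)] has_derivative_continuous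
    by (blast intro: continuous_at_imp_continuous_on)
next
  case (Suc k)
  have "Ck_on (Suc 0) S f" by (rule Ck_on_mono[OF Suc.prems(1)]) simp
  note D = has_derivative_segment_integral[OF L Suc.prems(2) T A this]
  show ?case
    by (rule Ck_on_SucI[OF T(1) D])
      (auto intro!: Ck_on_add[OF T(1)] Suc.IH Ck_on_SucD(2)[OF Suc.prems(1)] Suc.prems(2) continuous_on_mult
       continuous_on_id simp del: Ck_on.simps)
qed

text \<open>The first identity is the fundamental theorem of calculus along the segment and drives
  Hadamard's lemma. The second is integration by parts with the primitive
  \<open>- (1 - t) f(x + t v)\<close>, which vanishes at \<open>t = 1\<close>; it computes the
  partial derivative of an antiderivative.\<close>

lemma segment_integral_derivative:
  fixes f :: "'a::euclidean_space \<Rightarrow> real"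
  assumes f: "Ck_on (Suc 0) S f" and A: "\<And>t. t \<in> {0..1} \<Longrightarrow> x + t *\<^sub>R v \<in> S"
  shows "integral {0..1} (\<lambda>t. frechet_derivative f (at (x + t *\<^sub>R v)) v) = f (x + v) - f x"
    and "integral {0..1} (\<lambda>t. f (x + t *\<^sub>R v)) - integral {0..1} (\<lambda>t. (1 - t) * frechet_derivative f (at (x + t *\<^sub>R v)) v) = f x"
proof -
  note fd = Ck_on_SucD[OF f]
  have D: "((\<lambda>t. f (x + t *\<^sub>R v)) has_derivative (\<lambda>s. frechet_derivative f (at (x + t *\<^sub>R v)) (s *\<^sub>R v))) (at t within {0..1})"
    if "t \<in> {0..1}" for t
  proof -
    have "((\<lambda>t. x + t *\<^sub>R v) has_derivative (\<lambda>s. s *\<^sub>R v)) (at t within {0..1})"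
      by (auto intro!: derivative_eq_intros)
    from has_derivative_compose[OF this fd(1)[OF A[OF that]]] show ?thesis .
  qed
  have vD: "((\<lambda>t. f (x + t *\<^sub>R v)) has_vector_derivative frechet_derivative f (at (x + t *\<^sub>R v)) v) (at t within {0..1})"
    if "t \<in> {0..1}" for t
  proof -
    have "linear (frechet_derivative f (at (x + t *\<^sub>R v)))"
      using fd(1)[OF A[OF that]] has_derivative_linear by blast
    then show ?thesis
      using D[OF that] by (simp add: has_vector_derivative_def linear_cmul)
  qed
  have "((\<lambda>t. frechet_derivative f (at (x + t *\<^sub>R v)) v) has_integral f (x + 1 *\<^sub>R v) - f (x + 0 *\<^sub>R v)) {0..1}"
    by (rule fundamental_theorem_of_calculus[OF _ vD]) auto
  then show 1: "integral {0..1} (\<lambda>t. frechet_derivative f (at (x + t *\<^sub>R v)) v) = f (x + v) - f x"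
    by (simp add: integral_unique)
  have vD': "((\<lambda>t. - ((1 - t) * f (x + t *\<^sub>R v))) has_vector_derivative
      f (x + t *\<^sub>R v) - (1 - t) * frechet_derivative f (at (x + t *\<^sub>R v)) v) (at t within {0..1})"
    if "t \<in> {0..1}" for t
    using vD[OF that]
    by (auto simp flip: has_real_derivative_iff_has_vector_derivative intro!: derivative_eq_intros)
  have c1: "continuous_on {0..1} (\<lambda>t. f (x + t *\<^sub>R v))"
    unfolding continuous_on_eq_continuous_within
    using has_vector_derivative_continuous[OF vD] by simp
  have c2: "continuous_on {0..1} (\<lambda>t. frechet_derivative f (at (x + t *\<^sub>R v)) v)"
    using fd(2)[of v] A by (auto intro!: continuous_on_compose2[of S "\<lambda>y. frechet_derivative f (at y) v"] continuous_on_add continuous_on_scaleR continuous_on_const continuous_on_id)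
  have "((\<lambda>t. f (x + t *\<^sub>R v) - (1 - t) * frechet_derivative f (at (x + t *\<^sub>R v)) v) has_integral
      - ((1 - 1) * f (x + 1 *\<^sub>R v)) - (- ((1 - 0) * f (x + 0 *\<^sub>R v)))) {0..1}"
    by (rule fundamental_theorem_of_calculus[OF _ vD']) auto
  then have "integral {0..1} (\<lambda>t. f (x + t *\<^sub>R v) - (1 - t) * frechet_derivative f (at (x + t *\<^sub>R v)) v) = f x"
    by (simp add: integral_unique)
  moreover have "integral {0..1} (\<lambda>t. f (x + t *\<^sub>R v) - (1 - t) * frechet_derivative f (at (x + t *\<^sub>R v)) v) =
    integral {0..1} (\<lambda>t. f (x + t *\<^sub>R v)) - integral {0..1} (\<lambda>t. (1 - t) * frechet_derivative f (at (x + t *\<^sub>R v)) v)"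
    by (intro integral_diff integrable_continuous_real c1 continuous_on_mult c2 continuous_on_diff continuous_on_const continuous_on_id)
  ultimately show "integral {0..1} (\<lambda>t. f (x + t *\<^sub>R v)) - integral {0..1} (\<lambda>t. (1 - t) * frechet_derivative f (at (x + t *\<^sub>R v)) v) = f x"
    by simp
qed

subsection \<open>Maps of the plane with prescribed Jacobian determinant\<close>

definition det2 :: "real ^ 2 \<Rightarrow> real ^ 2 \<Rightarrow> real" where
  "det2 v w = v $ 1 * w $ 2 - v $ 2 * w $ 1"

lemma vec2_eq_axis: "v = v $ 1 *\<^sub>R axis 1 1 + v $ 2 *\<^sub>R axis 2 (1::real)" for v :: "real ^ 2"
  by (simp add: vec_eq_iff forall_2 axis_def)

text \<open>Rescaling the interval between \<open>a $ 1\<close> and \<open>x $ 1\<close> to [0, 1]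
  writes the antiderivative as \<open>x $ 1 - a $ 1\<close> times the average of \<open>s\<close>
  over the horizontal segment from \<open>x\<close> to the vertical line through \<open>a\<close>.
  Thus no variable limit of integration has to be differentiated.\<close>

lemma partial_antiderivative:
  fixes s :: "real ^ 2 \<Rightarrow> real"
  assumes s: "smooth_on (ball a r) s"
  obtains F where "smooth_on (ball a r) F"
    "\<And>x. x \<in> ball a r \<Longrightarrow> frechet_derivative F (at x) (axis 1 1) = s x"
proof
  let ?B = "ball a r" and ?e = "axis 1 1 :: real ^ 2"
  define L :: "real ^ 2 \<Rightarrow> real ^ 2" where "L x = (- (x $ 1)) *\<^sub>R ?e" for x
  define d where "d = (a $ 1) *\<^sub>R ?e"
  define G where "G x = integral {0..1} (\<lambda>t. 1 * s (x + t *\<^sub>R (L x + d)))" for x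
  let ?F = "\<lambda>x. (x $ 1 - a $ 1) * G x"
  have L: "bounded_linear L"
    unfolding L_def
    by (intro bounded_linear_compose[OF bounded_linear_scaleR_left] bounded_linear_minus bounded_linear_vec_nth)
  have Ld: "L x + d = (a $ 1 - x $ 1) *\<^sub>R ?e" for x
    by (simp add: L_def d_def algebra_simps)
  \<comment> \<open>Moving towards that line shrinks the first component of \<open>x - a\<close> and
    keeps the second, so the segment stays in the ball.\<close>
  have A: "x + t *\<^sub>R (L x + d) \<in> ?B" if x: "x \<in> ?B" and t: "t \<in> {0..1}" for x t
  proof -
    have "norm (x + t *\<^sub>R (L x + d) - a) \<le> norm (x - a)"
    proof (rule norm_le_componentwise_cart)
      fix i :: 2
      have "\<bar>x $ 1 + t * (a $ 1 - x $ 1) - a $ 1\<bar> = (1 - t) * \<bar>x $ 1 - a $ 1\<bar>"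
      proof -
        have "x $ 1 + t * (a $ 1 - x $ 1) - a $ 1 = (1 - t) * (x $ 1 - a $ 1)"
          by (simp add: algebra_simps)
        then show ?thesis using t by (simp add: abs_mult)
      qed
      also have "\<dots> \<le> \<bar>x $ 1 - a $ 1\<bar>" using t by (intro mult_left_le_one_le) auto
      finally show "norm ((x + t *\<^sub>R (L x + d) - a) $ i) \<le> norm ((x - a) $ i)"
        using exhaust_2[of i] by (auto simp: Ld axis_def)
    qed
    then show ?thesis using x by (simp add: dist_norm norm_minus_commute)
  qed
  have sk: "Ck_on k ?B s" for k using s by (simp add: smooth_on_def)
  have Gk: "Ck_on k ?B G" for k
    unfolding G_def
    by (rule Ck_on_segment_integral[OF L continuous_on_const open_ball convex_ball A sk])
  have xk: "Ck_on k ?B (\<lambda>x. x $ 1 - a $ 1)" for k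
    using Ck_on_add[OF open_ball Ck_on_linear[OF bounded_linear_vec_nth[of 1] open_ball] Ck_on_const[of k ?B "- (a $ 1)"]]
    by simp
  show "smooth_on ?B ?F"
    unfolding smooth_on_def by (intro allI Ck_on_mult open_ball xk Gk)
  fix x assume x: "x \<in> ?B"
  let ?A = "\<lambda>t. x + t *\<^sub>R (L x + d)"
  let ?s = "\<lambda>t. frechet_derivative s (at (?A t))"
  have lin: "linear (?s t)" if "t \<in> {0..1}" for t
    using Ck_on_SucD(1)[OF sk[of "Suc 0"] A[OF x that]] has_derivative_linear by blast
  define J where "J = integral {0..1} (\<lambda>t. (1 - t) * ?s t ?e)"
  have Le: "L ?e = - ?e" by (simp add: L_def)
  have cs: "continuous_on {0..1} (\<lambda>t. ?s t ?e)"
    by (rule continuous_on_compose2[OF Ck_on_imp_continuous_on[OF Ck_on_SucD(2)[OF sk[of "Suc 0"]]]])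
      (use A[OF x] in \<open>auto intro!: continuous_on_add continuous_on_scaleR continuous_on_const continuous_on_id\<close>)
  have "(G has_derivative (\<lambda>v. integral {0..1} (\<lambda>t. 1 * ?s t v) + integral {0..1} (\<lambda>t. (1 * t) * ?s t (L v)))) (at x)"
    unfolding G_def
    by (rule has_derivative_segment_integral[OF L continuous_on_const open_ball convex_ball A sk x])
  \<comment> \<open>As \<open>L\<close> sends the first axis vector to its negative, the weights
    \<open>1\<close> and \<open>t\<close> combine to \<open>1 - t\<close>, the weight of the
    integration by parts below.\<close>
  moreover have "integral {0..1} (\<lambda>t. 1 * ?s t ?e) + integral {0..1} (\<lambda>t. (1 * t) * ?s t (L ?e)) = J"
  proof -
    have "integral {0..1} (\<lambda>t. (1 * t) * ?s t (L ?e)) = integral {0..1} (\<lambda>t. - t * ?s t ?e)"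
      using lin by (intro integral_cong) (auto simp: Le linear_neg)
    moreover have "integral {0..1} (\<lambda>t. 1 * ?s t ?e) + integral {0..1} (\<lambda>t. - t * ?s t ?e) =
        integral {0..1} (\<lambda>t. 1 * ?s t ?e + - t * ?s t ?e)"
      by (intro integral_add[symmetric] integrable_continuous_real continuous_on_mult cs
          continuous_on_const continuous_on_id continuous_on_minus)
    ultimately show ?thesis by (simp add: J_def algebra_simps)
  qed
  ultimately obtain DG where DG: "(G has_derivative DG) (at x)" "DG ?e = J" by blast
  have "(?F has_derivative (\<lambda>v. (x $ 1 - a $ 1) * DG v + (v $ 1) * G x)) (at x)"
    by (rule has_derivative_mult[OF _ DG(1)])
      (auto intro!: derivative_eq_intros bounded_linear.has_derivative[OF bounded_linear_vec_nth])
  then have "frechet_derivative ?F (at x) = (\<lambda>v. (x $ 1 - a $ 1) * DG v + (v $ 1) * G x)"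
    by (rule frechet_derivative_at[symmetric])
  then have FJ: "frechet_derivative ?F (at x) ?e = (x $ 1 - a $ 1) * J + G x"
    by (simp add: DG(2))
  have "G x - integral {0..1} (\<lambda>t. (1 - t) * ?s t (L x + d)) = s x"
    using segment_integral_derivative(2)[OF sk A[OF x]] by (simp add: G_def)
  moreover have "integral {0..1} (\<lambda>t. (1 - t) * ?s t (L x + d)) =
      integral {0..1} (\<lambda>t. (a $ 1 - x $ 1) * ((1 - t) * ?s t ?e))"
    using lin by (intro integral_cong) (simp add: Ld linear_cmul)
  ultimately have "G x - (a $ 1 - x $ 1) * J = s x" by (simp add: J_def)
  then show "frechet_derivative ?F (at x) ?e = s x" using FJ by (simp add: algebra_simps)
qed

text \<open>The derivative of \<open>h = (F, x $ 2)\<close> is the triangular matrix with rows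
  \<open>(s, q)\<close> and \<open>(0, 1)\<close>, where \<open>q\<close> is the partial derivative
  of \<open>F\<close> in the second variable. Its determinant is \<open>s\<close>, and its inverse
  is explicit, which makes the regularity of the inverse map a direct induction.\<close>

lemma prescribed_jacobian_diffeomorphism:
  fixes s :: "real ^ 2 \<Rightarrow> real"
  assumes s: "smooth_on (ball a r) s" and pos: "\<And>x. x \<in> ball a r \<Longrightarrow> s x > 0"
  obtains h k where "smooth_on (ball a r) h" "open (h ` ball a r)" "smooth_on (h ` ball a r) k"
    "\<And>x. x \<in> ball a r \<Longrightarrow> k (h x) = x"
    "\<And>x v w. x \<in> ball a r \<Longrightarrow> det2 (frechet_derivative h (at x) v) (frechet_derivative h (at x) w) = s x * det2 v w"
proof -
  let ?B = "ball a r" and ?e1 = "axis 1 1 :: real ^ 2" and ?e2 = "axis 2 1 :: real ^ 2"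
  obtain F where F: "smooth_on ?B F" "\<And>x. x \<in> ?B \<Longrightarrow> frechet_derivative F (at x) ?e1 = s x"
    using partial_antiderivative[OF s] by blast
  define q where "q x = frechet_derivative F (at x) ?e2" for x
  define h :: "real ^ 2 \<Rightarrow> real ^ 2" where "h x = F x *\<^sub>R ?e1 + x $ 2 *\<^sub>R ?e2" for x
  define h' :: "real ^ 2 \<Rightarrow> real ^ 2 \<Rightarrow> real ^ 2" where "h' x v = (v $ 1 * s x + v $ 2 * q x) *\<^sub>R ?e1 + v $ 2 *\<^sub>R ?e2" for x v
  have sk: "Ck_on k ?B s" and Fk: "Ck_on k ?B F" for k
    using s F(1) by (simp_all add: smooth_on_def)
  have qk: "Ck_on k ?B q" for k unfolding q_def by (rule Ck_on_SucD(2)[OF Fk])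
  have hk: "Ck_on k ?B h" for k
    unfolding h_def
    by (intro Ck_on_add open_ball Ck_on_bounded_linear[OF bounded_linear_scaleR_left] Fk
        Ck_on_linear[OF bounded_linear_vec_nth])
  have DF: "(F has_derivative (\<lambda>v. v $ 1 * s x + v $ 2 * q x)) (at x)" if x: "x \<in> ?B" for x
  proof -
    note D = Ck_on_SucD(1)[OF Fk x]
    have "frechet_derivative F (at x) v = v $ 1 * s x + v $ 2 * q x" for v
    proof -
      have "frechet_derivative F (at x) v = frechet_derivative F (at x) (v $ 1 *\<^sub>R ?e1 + v $ 2 *\<^sub>R ?e2)"
        by (simp only: vec2_eq_axis[symmetric])
      then show ?thesis
        by (simp add: F(2)[OF x] q_def linear_add[OF has_derivative_linear[OF D]] linear_cmul[OF has_derivative_linear[OF D]])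
    qed
    then have "frechet_derivative F (at x) = (\<lambda>v. v $ 1 * s x + v $ 2 * q x)" by (rule ext)
    with D show ?thesis by simp
  qed
  have Dh: "(h has_derivative h' x) (at x)" if x: "x \<in> ?B" for x
    unfolding h_def h'_def
    by (intro has_derivative_add has_derivative_scaleR_left DF[OF x]
        bounded_linear.has_derivative[OF bounded_linear_vec_nth] has_derivative_ident)
  have h_nth: "h x $ 1 = F x" "h x $ 2 = x $ 2" for x
    by (simp_all add: h_def axis_def)
  \<comment> \<open>Points with equal images lie on one horizontal line. By the mean value theorem
    the increment of \<open>F\<close> between them is \<open>y $ 1 - x $ 1\<close> times a positive
    value of \<open>s\<close>.\<close>
  have inj: "inj_on h ?B"
  proof (rule inj_onI)
    fix x y assume x: "x \<in> ?B" and y: "y \<in> ?B" and e: "h x = h y"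
    have e2: "x $ 2 = y $ 2" and eF: "F x = F y" using h_nth e by metis+
    let ?l = "\<lambda>t. x + t *\<^sub>R (y - x)"
    have l: "?l t \<in> ?B" if "t \<in> {0..1}" for t
    proof -
      have "?l t = (1 - t) *\<^sub>R x + t *\<^sub>R y" by (simp add: algebra_simps)
      then show ?thesis using convexD[OF convex_ball x y, of "1 - t" t] that by simp
    qed
    have "((\<lambda>t. F (?l t)) has_derivative (\<lambda>u. (u *\<^sub>R (y - x)) $ 1 * s (?l t) + (u *\<^sub>R (y - x)) $ 2 * q (?l t))) (at t within {0..1})"
      if "t \<in> {0..1}" for t
    proof -
      have "(?l has_derivative (\<lambda>u. u *\<^sub>R (y - x))) (at t within {0..1})"
        by (auto intro!: derivative_eq_intros)
      from has_derivative_compose[OF this DF[OF l[OF that]]] show ?thesis .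
    qed
    from mvt_simple[of 0 1 "\<lambda>t. F (?l t)", OF _ this]
    obtain t where t: "t \<in> {0<..<1}" "F (?l 1) - F (?l 0) = (y $ 1 - x $ 1) * s (?l t)"
      using e2 by auto
    then have "y $ 1 = x $ 1" using eF pos[OF l[of t]] by auto
    then show "x = y" using e2 by (simp add: vec_eq_iff forall_2)
  qed
  let ?k = "inv_into ?B h"
  have kh: "?k (h x) = x" if "x \<in> ?B" for x using inj that by simp
  have op: "open (h ` ?B)"
    by (rule invariance_of_domain[OF Ck_on_imp_continuous_on[OF hk] open_ball inj])
  \<comment> \<open>The inverse of the triangular matrix, with \<open>powr (-1)\<close> for the
    reciprocal so that \<open>Ck_on_powr\<close> covers it.\<close>
  have Dk: "(?k has_derivative (\<lambda>v. ((v $ 1 + - (v $ 2) * q (?k y)) * s (?k y) powr (-1)) *\<^sub>R ?e1 + v $ 2 *\<^sub>R ?e2)) (at y)"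
    if y: "y \<in> h ` ?B" for y
  proof -
    obtain x where x: "x \<in> ?B" "y = h x" using y by auto
    have "h' x \<circ> (\<lambda>v. ((v $ 1 + - (v $ 2) * q x) * s x powr (-1)) *\<^sub>R ?e1 + v $ 2 *\<^sub>R ?e2) = id"
      using less_imp_neq[OF pos[OF x(1)]] pos[OF x(1)]
      by (auto simp: h'_def fun_eq_iff vec_eq_iff forall_2 axis_def powr_minus field_simps)
    from has_derivative_inverse_strong[OF open_ball x(1) Ck_on_imp_continuous_on[OF hk] kh Dh[OF x(1)] this]
    show ?thesis using x kh by simp
  qed
  \<comment> \<open>Bootstrapping: the derivative of the inverse is built from \<open>s\<close> and
    \<open>q\<close> composed with the inverse itself, so it inherits order \<open>n\<close> and
    lifts the inverse to order \<open>n + 1\<close>.\<close>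
  have kk: "Ck_on n (h ` ?B) ?k" for n
  proof (induction n)
    case 0
    show ?case unfolding Ck_on.simps
      using Dk has_derivative_continuous by (blast intro: continuous_at_imp_continuous_on)
  next
    case (Suc n)
    have k_im: "?k ` (h ` ?B) \<subseteq> ?B" using kh by auto
    have sn: "Ck_on n (h ` ?B) (\<lambda>y. s (?k y))" and qn: "Ck_on n (h ` ?B) (\<lambda>y. q (?k y))"
      by (rule Ck_on_compose[OF op open_ball k_im sk Suc], rule Ck_on_compose[OF op open_ball k_im qk Suc])
    have spos: "(\<lambda>y. s (?k y)) ` h ` ?B \<subseteq> {0<..}" using k_im pos by (auto simp: image_subset_iff)
    have pn: "Ck_on n (h ` ?B) (\<lambda>y. s (?k y) powr (-1))"
      by (rule Ck_on_compose[OF op open_greaterThan spos Ck_on_powr sn])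
    show ?case
      by (rule Ck_on_SucI[OF op Dk], assumption)
        (intro Ck_on_add Ck_on_bounded_linear[OF bounded_linear_scaleR_left] Ck_on_mult op pn qn Ck_on_const)
  qed
  show thesis
  proof (rule that)
    show "det2 (frechet_derivative h (at x) v) (frechet_derivative h (at x) w) = s x * det2 v w"
      if "x \<in> ?B" for x v w
      unfolding frechet_derivative_at[OF Dh[OF that], symmetric]
      by (simp add: det2_def h'_def axis_def algebra_simps)
  qed (use hk op kk kh in \<open>auto simp: smooth_on_def\<close>)
qed

subsection \<open>Smooth functions and Hadamard's lemma\<close>

lemma smooth_on_subset: "smooth_on S f \<Longrightarrow> T \<subseteq> S \<Longrightarrow> smooth_on T f"
  unfolding smooth_on_def by (intro allI Ck_on_subset[of _ S f T]) auto

lemma smooth_on_cong: "open S \<Longrightarrow> (\<And>x. x \<in> S \<Longrightarrow> f x = f' x) \<Longrightarrow> smooth_on S f \<longleftrightarrow> smooth_on S f'"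
  unfolding smooth_on_def using Ck_on_cong[of S f f'] by simp

lemma smooth_on_transform:
  "smooth_on S f \<Longrightarrow> open S \<Longrightarrow> (\<And>x. x \<in> S \<Longrightarrow> f x = f' x) \<Longrightarrow> smooth_on S f'"
  using smooth_on_cong[of S f f'] by simp

lemma smooth_on_local:
  "(\<And>x. x \<in> S \<Longrightarrow> \<exists>T. open T \<and> x \<in> T \<and> smooth_on T f) \<Longrightarrow> smooth_on S f"
  unfolding smooth_on_def by (intro allI Ck_on_local) blast

lemma smooth_on_const [simp]: "smooth_on S (\<lambda>x. c)"
  by (simp add: smooth_on_def)

lemma smooth_on_add: "open S \<Longrightarrow> smooth_on S f \<Longrightarrow> smooth_on S g \<Longrightarrow> smooth_on S (\<lambda>x. f x + g x)"
  by (simp add: smooth_on_def Ck_on_add)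

lemma smooth_on_mult:
  fixes f g :: "'a::real_normed_vector \<Rightarrow> real"
  shows "open S \<Longrightarrow> smooth_on S f \<Longrightarrow> smooth_on S g \<Longrightarrow> smooth_on S (\<lambda>x. f x * g x)"
  by (simp add: smooth_on_def Ck_on_mult)

lemma smooth_on_linear: "bounded_linear f \<Longrightarrow> open S \<Longrightarrow> smooth_on S f"
  by (simp add: smooth_on_def Ck_on_linear)

lemma smooth_on_bounded_linear:
  "bounded_linear L \<Longrightarrow> open S \<Longrightarrow> smooth_on S f \<Longrightarrow> smooth_on S (\<lambda>x. L (f x))"
  by (simp add: smooth_on_def Ck_on_bounded_linear)

lemma smooth_on_compose:
  fixes f :: "'b::euclidean_space \<Rightarrow> 'c::real_normed_vector" and g :: "'a::real_normed_vector \<Rightarrow> 'b"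
  assumes "open S" "open T" "g ` S \<subseteq> T" "smooth_on T f" "smooth_on S g"
  shows "smooth_on S (\<lambda>x. f (g x))"
  unfolding smooth_on_def
proof
  show "Ck_on k S (\<lambda>x. f (g x))" for k
    using assms(4,5) unfolding smooth_on_def by (intro Ck_on_compose[OF assms(1-3), of k f]) auto
qed

lemma smooth_on_powr: "smooth_on {0<..} (\<lambda>x::real. x powr a)"
  by (simp add: smooth_on_def Ck_on_powr)

lemma smooth_on_frechet_derivative:
  "smooth_on S f \<Longrightarrow> smooth_on S (\<lambda>x. frechet_derivative f (at x) v)"
  unfolding smooth_on_def by (intro allI Ck_on_SucD(2)) simp

lemma smooth_on_has_derivative:
  "smooth_on S f \<Longrightarrow> x \<in> S \<Longrightarrow> (f has_derivative frechet_derivative f (at x)) (at x)"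
  unfolding smooth_on_def by (rule Ck_on_SucD(1)[of 0]) simp_all

lemma smooth_on_imp_continuous_on: "smooth_on S f \<Longrightarrow> continuous_on S f"
  unfolding smooth_on_def by (rule Ck_on_imp_continuous_on[of 0]) simp

text \<open>\<open>G i\<close> averages the \<open>i\<close>-th partial derivative over the segment
  from \<open>x\<close> to \<open>a\<close>; at \<open>x = a\<close> the segment is a point, which
  gives the last claim. The factors \<open>x $ i - a $ i\<close> vanish at \<open>a\<close>, so a
  derivation at \<open>a\<close> sees only the values \<open>G i a\<close> of the
  coefficients.\<close>

lemma hadamard:
  fixes f :: "real ^ 'n::finite \<Rightarrow> real"
  assumes f: "smooth_on (ball a r) f"
  obtains G where "\<And>i. smooth_on (ball a r) (G i)"
    "\<And>x. x \<in> ball a r \<Longrightarrow> f x = f a + (\<Sum>i\<in>UNIV. (x $ i - a $ i) * G i x)"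
    "\<And>i. G i a = frechet_derivative f (at a) (axis i 1)"
proof
  let ?D = "\<lambda>i y. frechet_derivative f (at y) (axis i 1)"
  let ?G = "\<lambda>i x. integral {0..1} (\<lambda>t. 1 * ?D i (x + t *\<^sub>R (- x + a)))"
  have fk: "Ck_on k (ball a r) f" for k using f by (simp add: smooth_on_def)
  have A: "x + t *\<^sub>R (- x + a) \<in> ball a r" if x: "x \<in> ball a r" and t: "t \<in> {0..1}" for x t
  proof -
    have "x + t *\<^sub>R (- x + a) = (1 - t) *\<^sub>R x + t *\<^sub>R a" by (simp add: algebra_simps)
    moreover have "a \<in> ball a r" using x by (metis ball_eq_empty centre_in_ball empty_iff not_le)
    ultimately show ?thesis using convexD[OF convex_ball x, of a "1 - t" t] t by simp
  qed
  have Dk: "Ck_on k (ball a r) (?D i)" for k i by (rule Ck_on_SucD(2)[OF fk])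
  show "smooth_on (ball a r) (?G i)" for i
    unfolding smooth_on_def
    by (intro allI Ck_on_segment_integral[OF bounded_linear_minus[OF bounded_linear_ident] continuous_on_const open_ball convex_ball A Dk])
  show "?G i a = ?D i a" for i by simp
  fix x assume x: "x \<in> ball a r"
  have "f a - f x = integral {0..1} (\<lambda>t. frechet_derivative f (at (x + t *\<^sub>R (- x + a))) (- x + a))"
    using segment_integral_derivative(1)[OF fk A[OF x]] by simp
  also have "\<dots> = integral {0..1} (\<lambda>t. \<Sum>i\<in>UNIV. (a $ i - x $ i) * ?D i (x + t *\<^sub>R (- x + a)))"
  proof (rule integral_cong)
    fix t :: real assume t: "t \<in> {0..1}"
    let ?F = "frechet_derivative f (at (x + t *\<^sub>R (- x + a)))"
    have lin: "linear ?F" using Ck_on_SucD(1)[OF fk A[OF x t]] has_derivative_linear by blast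
    have "?F (- x + a) = ?F (\<Sum>i\<in>UNIV. (- x + a) $ i *\<^sub>R axis i 1)"
      by (simp only: basis_expansion scalar_mult_eq_scaleR[symmetric])
    also have "\<dots> = (\<Sum>i\<in>UNIV. (- x + a) $ i * ?F (axis i 1))"
      by (simp only: linear_sum[OF lin] linear_cmul[OF lin] real_scaleR_def)
    finally show "?F (- x + a) = (\<Sum>i\<in>UNIV. (a $ i - x $ i) * ?F (axis i 1))"
      by simp
  qed
  also have "\<dots> = (\<Sum>i\<in>UNIV. integral {0..1} (\<lambda>t. (a $ i - x $ i) * ?D i (x + t *\<^sub>R (- x + a))))"
  proof (rule integral_sum)
    fix i :: 'n
    have "continuous_on {0..1} (\<lambda>t. ?D i (x + t *\<^sub>R (- x + a)))"
      by (rule continuous_on_compose2[OF Ck_on_imp_continuous_on[OF Dk]])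
        (use A[OF x] in \<open>auto intro!: continuous_on_add continuous_on_scaleR continuous_on_const continuous_on_id\<close>)
    then show "(\<lambda>t. (a $ i - x $ i) * ?D i (x + t *\<^sub>R (- x + a))) integrable_on {0..1}"
      by (intro integrable_continuous_real continuous_on_mult continuous_on_const)
  qed simp
  also have "\<dots> = (\<Sum>i\<in>UNIV. (a $ i - x $ i) * ?G i x)" by simp
  also have "\<dots> = - (\<Sum>i\<in>UNIV. (x $ i - a $ i) * ?G i x)"
    by (simp add: sum_negf[symmetric] algebra_simps)
  finally show "f x = f a + (\<Sum>i\<in>UNIV. (x $ i - a $ i) * ?G i x)" by simp
qed

subsection \<open>2-inner products on a plane\<close>

text \<open>The axioms give no linearity in the third slot, so \<open>w\<close> cannot be expanded
  there directly. Instead \<open>u\<close> and \<open>v\<close> are reduced modulo \<open>w\<close>,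
  after multiplication by a coordinate of \<open>w\<close>, and the remaining
  \<open>g(e, e/w)\<close> is turned into \<open>g(w, w/e)\<close>, where \<open>w\<close> stands in
  linear slots.\<close>

lemma two_inner_product_on_plane:
  assumes V: "subspace V" and g: "two_inner_product_on V g" and e: "e1 \<in> V" "e2 \<in> V"
  shows "g (a1 *\<^sub>R e1 + a2 *\<^sub>R e2) (b1 *\<^sub>R e1 + b2 *\<^sub>R e2) (c1 *\<^sub>R e1 + c2 *\<^sub>R e2) =
    g e1 e1 e2 * ((a1 * c2 - a2 * c1) * (b1 * c2 - b2 * c1))"
proof -
  have ge0: "g u u v \<ge> 0" and eq0: "g u u v = 0 \<longleftrightarrow> lin_dep u v" and flip: "g u u v = g v v u"
    if "u \<in> V" "v \<in> V" for u v
    using g that unfolding two_inner_product_on_def by blast+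
  have sym: "g u v w = g v u w" if "u \<in> V" "v \<in> V" "w \<in> V" for u v w
    using g that unfolding two_inner_product_on_def by blast
  have lin1: "g (\<alpha> *\<^sub>R u + u') v w = \<alpha> * g u v w + g u' v w"
    if "u \<in> V" "u' \<in> V" "v \<in> V" "w \<in> V" for \<alpha> u u' v w
    using g that unfolding two_inner_product_on_def by blast
  note zero = subspace_0[OF V] and cl = subspace_scale[OF V] and cladd = subspace_add[OF V]
  have lin2: "g v (\<alpha> *\<^sub>R u + u') w = \<alpha> * g v u w + g v u' w"
    if "u \<in> V" "u' \<in> V" "v \<in> V" "w \<in> V" for \<alpha> u u' v w
    using lin1[of u u' v w] sym that cl cladd by metis
  have zero1: "g 0 v w = 0" if "v \<in> V" "w \<in> V" for v w
    using lin1[OF zero zero that, of 1] by simp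
  have scale1: "g (\<alpha> *\<^sub>R u) v w = \<alpha> * g u v w" if "u \<in> V" "v \<in> V" "w \<in> V" for \<alpha> u v w
    using lin1[OF that(1) zero that(2,3), of \<alpha>] zero1[OF that(2,3)] by simp
  have scale2: "g v (\<alpha> *\<^sub>R u) w = \<alpha> * g v u w" if "u \<in> V" "v \<in> V" "w \<in> V" for \<alpha> u v w
    using scale1 sym that cl by metis
  have bil: "g (x *\<^sub>R u + y *\<^sub>R u') (x' *\<^sub>R v + y' *\<^sub>R v') w =
      x * x' * g u v w + x * y' * g u v' w + y * x' * g u' v w + y * y' * g u' v' w"
    if "u \<in> V" "u' \<in> V" "v \<in> V" "v' \<in> V" "w \<in> V" for x y x' y' u u' v v' w
  proof -
    have "g (x *\<^sub>R u + y *\<^sub>R u') (x' *\<^sub>R v + y' *\<^sub>R v') w =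
        x' * (x * g u v w + y * g u' v w) + y' * (x * g u v' w + y * g u' v' w)"
      using that by (simp add: lin1 lin2 scale1 scale2 cl cladd)
    then show ?thesis by (simp add: algebra_simps)
  qed
  have gww: "g w w w = 0" if "w \<in> V" for w
  proof -
    have "lin_dep w w" unfolding lin_dep_def by (rule exI[of _ 1], rule exI[of _ "-1"]) simp
    then show ?thesis using eq0 that by blast
  qed
  have gwvw: "g w v w = 0" if v: "v \<in> V" and w: "w \<in> V" for v w
  proof (rule ccontr)
    assume n: "g w v w \<noteq> 0"
    \<comment> \<open>As \<open>g(w, w/w) = 0\<close>, the value of \<open>g\<close> at
      \<open>t w + v\<close> is affine in \<open>t\<close>; this \<open>t\<close> makes it
      \<open>-1\<close>, against nonnegativity.\<close>
    define t where "t = - (g v v w + 1) / (2 * g w v w)"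
    have "0 \<le> g (t *\<^sub>R w + v) (t *\<^sub>R w + v) w"
      by (rule ge0[OF cladd[OF cl[OF w] v] w])
    also have "\<dots> = g v v w + 2 * t * g w v w"
      using bil[OF w v w v w, of t 1 t 1] gww[OF w] sym[OF v w w] by simp
    also have "\<dots> = -1" using n by (simp add: t_def field_simps)
    finally show False by simp
  qed
  have uw: "g (x *\<^sub>R e + y *\<^sub>R w) (x' *\<^sub>R e + y' *\<^sub>R w) w = x * x' * g e e w"
    if "e \<in> V" "w \<in> V" for x y x' y' e w
    using bil[OF that that that(2), of x y x' y'] gww[OF that(2)] gwvw[OF that] sym[OF that that(2)]
    by simp
  have ww: "g e e (x *\<^sub>R e + y *\<^sub>R e') = y\<^sup>2 * g e' e' e" if "e \<in> V" "e' \<in> V" for e e' x y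
  proof -
    have "g e e (x *\<^sub>R e + y *\<^sub>R e') = g (y *\<^sub>R e' + x *\<^sub>R e) (y *\<^sub>R e' + x *\<^sub>R e) e"
      using flip[OF that(1) cladd[OF cl[OF that(1)] cl[OF that(2)]]] by (simp add: add.commute)
    then show ?thesis using uw[OF that(2,1)] by (simp add: power2_eq_square)
  qed
  define u v w where "u = a1 *\<^sub>R e1 + a2 *\<^sub>R e2" and "v = b1 *\<^sub>R e1 + b2 *\<^sub>R e2" and "w = c1 *\<^sub>R e1 + c2 *\<^sub>R e2"
  have uvw: "u \<in> V" "v \<in> V" "w \<in> V" using e by (auto simp: u_def v_def w_def intro!: cladd cl)
  \<comment> \<open>Cramer's rule: multiplied by \<open>c2\<close>, the vectors \<open>u\<close> and
    \<open>v\<close> become determinants times \<open>e1\<close> modulo \<open>w\<close>. Keeping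
    the square of \<open>c2\<close> on both sides avoids a division.\<close>
  have 1: "c2\<^sup>2 * g u v w = c2\<^sup>2 * (g e1 e1 e2 * ((a1 * c2 - a2 * c1) * (b1 * c2 - b2 * c1)))"
  proof -
    have "c2 *\<^sub>R u = (a1 * c2 - a2 * c1) *\<^sub>R e1 + a2 *\<^sub>R w" "c2 *\<^sub>R v = (b1 * c2 - b2 * c1) *\<^sub>R e1 + b2 *\<^sub>R w"
      by (simp_all add: u_def v_def w_def algebra_simps)
    then have "g (c2 *\<^sub>R u) (c2 *\<^sub>R v) w = (a1 * c2 - a2 * c1) * (b1 * c2 - b2 * c1) * g e1 e1 w"
      using uw[OF e(1) uvw(3)] by simp
    moreover have "g (c2 *\<^sub>R u) (c2 *\<^sub>R v) w = c2\<^sup>2 * g u v w"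
      using uvw by (simp add: scale1 scale2 cl power2_eq_square)
    moreover have "g e1 e1 w = c2\<^sup>2 * g e1 e1 e2" using ww[OF e] flip[OF e] by (simp add: w_def)
    ultimately have "c2\<^sup>2 * g u v w = (a1 * c2 - a2 * c1) * (b1 * c2 - b2 * c1) * (c2\<^sup>2 * g e1 e1 e2)"
      by metis
    then show ?thesis by (simp add: algebra_simps)
  qed
  \<comment> \<open>The same reduction to multiples of \<open>e2\<close>, informative when
    \<open>c1\<close> is nonzero.\<close>
  have 2: "c1\<^sup>2 * g u v w = c1\<^sup>2 * (g e1 e1 e2 * ((a1 * c2 - a2 * c1) * (b1 * c2 - b2 * c1)))"
  proof -
    have "c1 *\<^sub>R u = (a2 * c1 - a1 * c2) *\<^sub>R e2 + a1 *\<^sub>R w" "c1 *\<^sub>R v = (b2 * c1 - b1 * c2) *\<^sub>R e2 + b1 *\<^sub>R w"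
      by (simp_all add: u_def v_def w_def algebra_simps)
    then have "g (c1 *\<^sub>R u) (c1 *\<^sub>R v) w = (a2 * c1 - a1 * c2) * (b2 * c1 - b1 * c2) * g e2 e2 w"
      using uw[OF e(2) uvw(3)] by simp
    moreover have "g (c1 *\<^sub>R u) (c1 *\<^sub>R v) w = c1\<^sup>2 * g u v w"
      using uvw by (simp add: scale1 scale2 cl power2_eq_square)
    moreover have "g e2 e2 w = c1\<^sup>2 * g e1 e1 e2" using ww[OF e(2,1), of c2 c1] by (simp add: w_def add.commute)
    ultimately have "c1\<^sup>2 * g u v w = (a2 * c1 - a1 * c2) * (b2 * c1 - b1 * c2) * (c1\<^sup>2 * g e1 e1 e2)"
      by metis
    then show ?thesis by (simp add: algebra_simps)
  qed
  \<comment> \<open>For \<open>w = 0\<close> both relations are void. Polarisation reduces the claim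
    to \<open>g(x, x/0) = 0\<close>, which holds because \<open>x\<close> and \<open>0\<close> are
    dependent.\<close>
  have 3: "g u v 0 = 0"
  proof -
    have "g x x 0 = 0" if "x \<in> V" for x
    proof -
      have "lin_dep x 0" unfolding lin_dep_def by (rule exI[of _ 0], rule exI[of _ 1]) simp
      then show ?thesis using eq0[OF that zero] by simp
    qed
    from this[OF uvw(1)] this[OF uvw(2)] this[OF cladd[OF uvw(1,2)]] show ?thesis
      using bil[OF uvw(1,2) uvw(1,2) zero, of 1 1 1 1] sym[OF uvw(2,1) zero] by simp
  qed
  have "g u v w = g e1 e1 e2 * ((a1 * c2 - a2 * c1) * (b1 * c2 - b2 * c1))"
  proof (cases "c1 = 0 \<and> c2 = 0")
    case True
    then show ?thesis using 3 by (simp add: w_def)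
  next
    case False
    then show ?thesis using 1 2 by auto
  qed
  then show ?thesis by (simp only: u_def v_def w_def)
qed

subsection \<open>Charts and tangent vectors\<close>

locale smooth_chart =
  fixes M :: "('a, 'n::finite) manifold" and U :: "'a set" and \<phi> :: "'a \<Rightarrow> real ^ 'n"
  assumes manifold: "smooth_manifold M" and chart: "(U, \<phi>) \<in> atlas M"
begin

abbreviation \<psi> :: "real ^ 'n \<Rightarrow> 'a" where "\<psi> \<equiv> inv_into U \<phi>"

lemma open_domain: "openin (topo M) U"
  and open_range: "open (\<phi> ` U)"
  and homeomorphic: "homeomorphic_map (subtopology (topo M) U) (top_of_set (\<phi> ` U)) \<phi>"
  using manifold chart by (auto simp: smooth_manifold_def is_chart_def)

lemma domain_subset: "U \<subseteq> pts M"
  using open_domain by (rule openin_subset)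

lemma inj: "inj_on \<phi> U"
  using homeomorphic_imp_injective_map[OF homeomorphic] domain_subset
  by (simp add: Int_absorb1)

lemma \<psi>_\<phi> [simp]: "x \<in> U \<Longrightarrow> \<psi> (\<phi> x) = x"
  using inj by simp

lemma \<phi>_\<psi>: "y \<in> \<phi> ` U \<Longrightarrow> \<phi> (\<psi> y) = y" and \<psi>_in: "y \<in> \<phi> ` U \<Longrightarrow> \<psi> y \<in> U"
  by (rule f_inv_into_f, assumption, rule inv_into_into)

lemma open_image:
  assumes "openin (topo M) W"
  shows "open (\<phi> ` (U \<inter> W))"
proof -
  have "openin (subtopology (topo M) U) (U \<inter> W)"
    using assms by (auto simp: openin_subtopology)
  then have "openin (top_of_set (\<phi> ` U)) (\<phi> ` (U \<inter> W))"
    using homeomorphic_imp_open_map[OF homeomorphic] by (simp add: open_map_def)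
  then show ?thesis using open_range openin_open_trans by blast
qed

lemma open_preimage:
  assumes "open B"
  shows "openin (topo M) {x \<in> U. \<phi> x \<in> B}"
proof -
  have "openin (top_of_set (\<phi> ` U)) (\<phi> ` U \<inter> B)" using assms by (simp add: openin_open_Int)
  then have "openin (subtopology (topo M) U) {x \<in> topspace (subtopology (topo M) U). \<phi> x \<in> \<phi> ` U \<inter> B}"
    by (rule openin_continuous_map_preimage[OF homeomorphic_imp_continuous_map[OF homeomorphic]])
  moreover have "{x \<in> topspace (subtopology (topo M) U). \<phi> x \<in> \<phi> ` U \<inter> B} = {x \<in> U. \<phi> x \<in> B}"
    using domain_subset by auto
  ultimately show ?thesis using open_domain by (metis (no_types, lifting) openin_open_subtopology)
qed

lemma continuous_\<psi>: "continuous_map (top_of_set (\<phi> ` U)) (topo M) \<psi>"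
proof -
  obtain k where k: "homeomorphic_maps (subtopology (topo M) U) (top_of_set (\<phi> ` U)) \<phi> k"
    using homeomorphic homeomorphic_map_maps by blast
  then have "continuous_map (top_of_set (\<phi> ` U)) (topo M) k"
    by (auto simp: homeomorphic_maps_def continuous_map_in_subtopology)
  moreover have "k y = \<psi> y" if "y \<in> topspace (top_of_set (\<phi> ` U))" for y
    using k that domain_subset by (auto simp: homeomorphic_maps_def)
  ultimately show ?thesis by (rule continuous_map_eq)
qed

lemma transition:
  assumes "(V, \<theta>) \<in> atlas M"
  shows "smooth_on (\<phi> ` (U \<inter> V)) (\<lambda>y. \<theta> (\<psi> y))"
  using manifold chart assms by (fastforce simp: smooth_manifold_def o_def)

text \<open>Smoothness of a function is defined through every chart of the atlas; the transition
  maps make the test in the given chart sufficient on open subsets of its domain.\<close>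

lemma smooth_fun_on_chart:
  assumes W: "openin (topo M) W" "W \<subseteq> U"
  shows "smooth_fun_on M W f \<longleftrightarrow> smooth_on (\<phi> ` W) (\<lambda>y. f (\<psi> y))"
proof
  assume "smooth_fun_on M W f"
  then have "smooth_on (\<phi> ` (U \<inter> W)) (f \<circ> \<psi>)" using chart by (auto simp: smooth_fun_on_def)
  then show "smooth_on (\<phi> ` W) (\<lambda>y. f (\<psi> y))" using W by (simp add: Int_absorb1 o_def)
next
  assume f: "smooth_on (\<phi> ` W) (\<lambda>y. f (\<psi> y))"
  have "smooth_on (\<theta> ` (V \<inter> W)) (f \<circ> inv_into V \<theta>)" if V: "(V, \<theta>) \<in> atlas M" for V \<theta>
  proof -
    interpret V: smooth_chart M V \<theta> by unfold_locales (rule manifold, rule V)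
    have op: "open (\<theta> ` (V \<inter> W))" by (rule V.open_image[OF W(1)])
    have "smooth_on (\<theta> ` (V \<inter> W)) (\<lambda>y. \<phi> (V.\<psi> y))"
      by (rule smooth_on_subset[OF V.transition[OF chart]]) (use W in auto)
    then have "smooth_on (\<theta> ` (V \<inter> W)) (\<lambda>y. f (\<psi> (\<phi> (V.\<psi> y))))"
      using open_image[OF W(1)] W by (intro smooth_on_compose[OF op _ _ f]) (auto simp: Int_absorb1)
    then show ?thesis
      by (rule smooth_on_transform[OF _ op]) (use W in auto)
  qed
  then show "smooth_fun_on M W f" by (auto simp: smooth_fun_on_def)
qed

lemma smooth_atI:
  assumes p: "p \<in> U" and B: "open B" "\<phi> p \<in> B" and G: "smooth_on B G"
    and fG: "\<And>x. x \<in> U \<Longrightarrow> \<phi> x \<in> B \<Longrightarrow> f x = G (\<phi> x)"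
  shows "smooth_at M p f"
proof -
  let ?W = "{x \<in> U. \<phi> x \<in> B}"
  have W: "openin (topo M) ?W" "?W \<subseteq> U" using open_preimage[OF B(1)] by auto
  have op: "open (\<phi> ` ?W)" using open_image[OF W(1)] W(2) by (simp add: Int_absorb1)
  have "smooth_on (\<phi> ` ?W) G" by (rule smooth_on_subset[OF G]) auto
  then have "smooth_on (\<phi> ` ?W) (\<lambda>y. f (\<psi> y))"
    by (rule smooth_on_transform[OF _ op]) (use fG in auto)
  then have "smooth_fun_on M ?W f" using smooth_fun_on_chart[OF W] by blast
  then show ?thesis unfolding smooth_at_def using W p B by blast
qed

lemma smooth_atE:
  assumes "smooth_at M p f" "p \<in> U"
  obtains r where "r > 0" "ball (\<phi> p) r \<subseteq> \<phi> ` U" "smooth_on (ball (\<phi> p) r) (\<lambda>y. f (\<psi> y))"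
proof -
  obtain W where W: "openin (topo M) W" "p \<in> W" "smooth_fun_on M W f"
    using assms by (auto simp: smooth_at_def)
  have "smooth_on (\<phi> ` (U \<inter> W)) (f \<circ> \<psi>)" using W(3) chart by (auto simp: smooth_fun_on_def)
  then have s: "smooth_on (\<phi> ` (U \<inter> W)) (\<lambda>y. f (\<psi> y))" by (simp add: o_def)
  have "\<phi> p \<in> \<phi> ` (U \<inter> W)" using W assms by auto
  then obtain r where "r > 0" "ball (\<phi> p) r \<subseteq> \<phi> ` (U \<inter> W)"
    using open_image[OF W(1)] openE by blast
  then show thesis using s by (intro that[of r]) (auto intro: smooth_on_subset)
qed

lemma smooth_at_has_derivative:
  assumes "smooth_at M p f" "p \<in> U"
  shows "((\<lambda>y. f (\<psi> y)) has_derivative frechet_derivative (\<lambda>y. f (\<psi> y)) (at (\<phi> p))) (at (\<phi> p))"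
proof -
  obtain r where r: "r > 0" "smooth_on (ball (\<phi> p) r) (\<lambda>y. f (\<psi> y))" using smooth_atE[OF assms] .
  show ?thesis by (rule smooth_on_has_derivative[OF r(2)]) (use r(1) in simp)
qed

lemma smooth_at_const: "p \<in> U \<Longrightarrow> smooth_at M p (\<lambda>x. c)"
  by (rule smooth_atI[of p UNIV "\<lambda>y. c"]) auto

lemma smooth_at_binop:
  assumes f: "smooth_at M p f" and f': "smooth_at M p f'" and p: "p \<in> U"
    and op: "\<And>S a b. open S \<Longrightarrow> smooth_on S a \<Longrightarrow> smooth_on S b \<Longrightarrow> smooth_on S (\<lambda>y :: real ^ 'n. h (a y) (b y))"
  shows "smooth_at M p (\<lambda>x. h (f x) (f' x))"
proof -
  obtain r where r: "r > 0" "smooth_on (ball (\<phi> p) r) (\<lambda>y. f (\<psi> y))" using smooth_atE[OF f p] .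
  obtain r' where r': "r' > 0" "smooth_on (ball (\<phi> p) r') (\<lambda>y. f' (\<psi> y))" using smooth_atE[OF f' p] .
  let ?B = "ball (\<phi> p) (min r r')"
  have "smooth_on ?B (\<lambda>y. h (f (\<psi> y)) (f' (\<psi> y)))"
    by (rule op[OF open_ball smooth_on_subset[OF r(2)] smooth_on_subset[OF r'(2)]]) auto
  then show ?thesis
    by (rule smooth_atI[OF p open_ball _ , rotated]) (use r r' in auto)
qed

lemma smooth_at_mult:
  "smooth_at M p f \<Longrightarrow> smooth_at M p f' \<Longrightarrow> p \<in> U \<Longrightarrow> smooth_at M p (\<lambda>x. f x * f' x)"
  by (rule smooth_at_binop[where h = "(*)"], assumption+, rule smooth_on_mult)

lemma smooth_at_lincomb:
  "smooth_at M p f \<Longrightarrow> smooth_at M p f' \<Longrightarrow> p \<in> U \<Longrightarrow> smooth_at M p (\<lambda>x. a * f x + f' x)"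
  by (rule smooth_at_binop[where h = "\<lambda>s t. a * s + t"])
    (auto simp: smooth_on_mult smooth_on_add)

lemma smooth_at_coord: "p \<in> U \<Longrightarrow> smooth_at M p (\<lambda>x. \<phi> x $ i)"
  by (rule smooth_atI[of p UNIV "\<lambda>y. y $ i"]) (auto intro: smooth_on_linear bounded_linear_vec_nth)

text \<open>The derivation with coordinate vector \<open>v\<close>. The value 0 off the smooth
  functions matches the normalisation in \<open>tangent_space\<close>, so that tangent vectors can
  be equal as functions.\<close>

definition chart_deriv :: "'a \<Rightarrow> real ^ 'n \<Rightarrow> 'a tangent" where
  "chart_deriv p v = (\<lambda>f. if smooth_at M p f then frechet_derivative (\<lambda>y. f (\<psi> y)) (at (\<phi> p)) v else 0)"

lemma chart_deriv_eq:
  assumes "smooth_at M p f" "((\<lambda>y. f (\<psi> y)) has_derivative D) (at (\<phi> p))"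
  shows "chart_deriv p v f = D v"
  using assms(1) frechet_derivative_at[OF assms(2)] by (simp add: chart_deriv_def)

lemma chart_deriv_coord:
  assumes p: "p \<in> U"
  shows "chart_deriv p v (\<lambda>x. \<phi> x $ i) = v $ i"
proof (rule chart_deriv_eq[OF smooth_at_coord[OF p]])
  show "((\<lambda>y. \<phi> (\<psi> y) $ i) has_derivative (\<lambda>v. v $ i)) (at (\<phi> p))"
    by (rule has_derivative_transform_within_open[OF bounded_linear_imp_has_derivative[OF bounded_linear_vec_nth] open_range])
      (use p \<phi>_\<psi> in auto)
qed

lemma chart_deriv_tangent:
  assumes p: "p \<in> U"
  shows "chart_deriv p v \<in> tangent_space M p"
proof -
  have "chart_deriv p v (\<lambda>x. a * f x + f' x) = a * chart_deriv p v f + chart_deriv p v f'"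
    "chart_deriv p v (\<lambda>x. f x * f' x) = chart_deriv p v f * f' p + f p * chart_deriv p v f'"
    if f: "smooth_at M p f" and f': "smooth_at M p f'" for a f f'
  proof -
    note D = smooth_at_has_derivative[OF f p] and D' = smooth_at_has_derivative[OF f' p]
    show "chart_deriv p v (\<lambda>x. a * f x + f' x) = a * chart_deriv p v f + chart_deriv p v f'"
      unfolding chart_deriv_eq[OF f D] chart_deriv_eq[OF f' D']
      by (rule chart_deriv_eq[OF smooth_at_lincomb[OF f f' p]
            has_derivative_add[OF has_derivative_mult_right[OF D] D']])
    show "chart_deriv p v (\<lambda>x. f x * f' x) = chart_deriv p v f * f' p + f p * chart_deriv p v f'"
      unfolding chart_deriv_eq[OF f D] chart_deriv_eq[OF f' D']
      using chart_deriv_eq[OF smooth_at_mult[OF f f' p] has_derivative_mult[OF D D']] p by simp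
  qed
  then show ?thesis by (simp add: tangent_space_def chart_deriv_def[of p v])
qed

lemma chart_deriv_lincomb:
  assumes p: "p \<in> U"
  shows "chart_deriv p (a *\<^sub>R v + b *\<^sub>R w) = a *\<^sub>R chart_deriv p v + b *\<^sub>R chart_deriv p w"
proof
  fix f
  show "chart_deriv p (a *\<^sub>R v + b *\<^sub>R w) f = (a *\<^sub>R chart_deriv p v + b *\<^sub>R chart_deriv p w) f"
  proof (cases "smooth_at M p f")
    case True
    note l = has_derivative_linear[OF smooth_at_has_derivative[OF True p]]
    show ?thesis using True by (simp add: chart_deriv_def linear_add[OF l] linear_cmul[OF l])
  qed (simp add: chart_deriv_def)
qed

section \<open>Derivations at a point are directional derivatives\<close>

lemma tangentD:
  assumes "u \<in> tangent_space M p" "smooth_at M p f" "smooth_at M p f'"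
  shows "u (\<lambda>x. a * f x + f' x) = a * u f + u f'" "u (\<lambda>x. f x * f' x) = u f * f' p + f p * u f'"
  using assms by (auto simp: tangent_space_def)

lemma tangent_const:
  assumes u: "u \<in> tangent_space M p" and p: "p \<in> U"
  shows "u (\<lambda>x. c) = 0"
proof -
  note s = smooth_at_const[OF p]
  have 1: "u (\<lambda>x. 1) = 0" using tangentD(2)[OF u s[of 1] s[of 1]] by simp
  then show ?thesis using tangentD(1)[OF u s[of 1] s[of 1], of "c - 1"] by simp
qed

text \<open>The difference \<open>d\<close> vanishes on \<open>W\<close>, hence
  \<open>d = d * \<theta>\<close> with \<open>\<theta>\<close> the indicator of the complement, and
  both factors vanish at \<open>p\<close>. A discontinuous indicator suffices because a derivation
  asks only for smoothness near \<open>p\<close>.\<close>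

lemma tangent_germ:
  assumes u: "u \<in> tangent_space M p" and p: "p \<in> U" and f: "smooth_at M p f" "smooth_at M p f'"
    and W: "openin (topo M) W" "p \<in> W" "\<And>x. x \<in> W \<Longrightarrow> f x = f' x"
  shows "u f = u f'"
proof -
  define \<theta> :: "'a \<Rightarrow> real" where "\<theta> x = (if x \<in> W then 0 else 1)" for x
  define d where "d x = -1 * f' x + f x" for x
  have d: "smooth_at M p d" unfolding d_def by (rule smooth_at_lincomb[OF f(2,1) p])
  have "smooth_at M p \<theta>"
  proof (rule smooth_atI[OF p])
    show "open (\<phi> ` (U \<inter> W))" by (rule open_image[OF W(1)])
    show "\<phi> p \<in> \<phi> ` (U \<inter> W)" using p W by auto
    show "smooth_on (\<phi> ` (U \<inter> W)) (\<lambda>y. 0)" by simp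
    show "\<theta> x = 0" if "x \<in> U" "\<phi> x \<in> \<phi> ` (U \<inter> W)" for x
      using that inj by (auto simp: \<theta>_def dest: inj_onD)
  qed
  moreover have "d = (\<lambda>x. d x * \<theta> x)" using W(3) by (auto simp: d_def \<theta>_def)
  ultimately have "u d = u d * \<theta> p + d p * u \<theta>" using tangentD(2)[OF u d] by metis
  then have "u d = 0" using W by (simp add: d_def \<theta>_def)
  then show ?thesis using tangentD(1)[OF u f(2,1), of "-1"] by (simp add: d_def[abs_def])
qed

lemma tangent_sum:
  assumes u: "u \<in> tangent_space M p" and p: "p \<in> U" and f: "\<And>i. i \<in> I \<Longrightarrow> smooth_at M p (f i)"
  shows "smooth_at M p (\<lambda>x. \<Sum>i\<in>I. f i x) \<and> u (\<lambda>x. \<Sum>i\<in>I. f i x) = (\<Sum>i\<in>I. u (f i))"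
  using f
proof (induction I rule: infinite_finite_induct)
  case (insert i I)
  then have "smooth_at M p (f i)" "smooth_at M p (\<lambda>x. \<Sum>i\<in>I. f i x)" by auto
  from smooth_at_lincomb[OF this p, of 1] tangentD(1)[OF u this, of 1] insert show ?case by simp
qed (use tangent_const[OF u p] smooth_at_const[OF p] in auto)

text \<open>Near \<open>p\<close> the function \<open>f\<close> equals its Hadamard expansion, and
  by locality \<open>u\<close> cannot tell them apart. The Leibniz rule leaves of each term only
  \<open>u\<close> of the coordinate times the partial derivative at \<open>p\<close>, since the
  shifted coordinate vanishes there.\<close>

lemma tangent_eq_chart_deriv:
  assumes u: "u \<in> tangent_space M p" and p: "p \<in> U"
  shows "u = chart_deriv p (\<chi> i. u (\<lambda>x. \<phi> x $ i))"
proof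
  fix f
  let ?v = "\<chi> i. u (\<lambda>x. \<phi> x $ i)"
  show "u f = chart_deriv p ?v f"
  proof (cases "smooth_at M p f")
    case False
    then show ?thesis using u by (simp add: tangent_space_def chart_deriv_def)
  next
    case f: True
    obtain r where r: "r > 0" "ball (\<phi> p) r \<subseteq> \<phi> ` U" "smooth_on (ball (\<phi> p) r) (\<lambda>y. f (\<psi> y))"
      by (rule smooth_atE[OF f p])
    let ?B = "ball (\<phi> p) r"
    obtain G where G: "\<And>i. smooth_on ?B (G i)"
      "\<And>y. y \<in> ?B \<Longrightarrow> f (\<psi> y) = f (\<psi> (\<phi> p)) + (\<Sum>i\<in>UNIV. (y $ i - \<phi> p $ i) * G i y)"
      "\<And>i. G i (\<phi> p) = frechet_derivative (\<lambda>y. f (\<psi> y)) (at (\<phi> p)) (axis i 1)"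
      by (rule hadamard[OF r(3)]) blast
    \<comment> \<open>The factors \<open>1 *\<close> and the added negatives give these functions
      literally the shape \<open>a * f + f'\<close> of the linearity axiom.\<close>
    let ?k = "\<lambda>i x. 1 * \<phi> x $ i + - (\<phi> p $ i)"
    let ?t = "\<lambda>i x. ?k i x * G i (\<phi> x)"
    let ?h = "\<lambda>x. 1 * (\<Sum>i\<in>UNIV. ?t i x) + f p"
    have sG: "smooth_at M p (\<lambda>x. G i (\<phi> x))" for i
      by (rule smooth_atI[OF p open_ball _ G(1)]) (use r(1) in auto)
    note c = smooth_at_const[OF p] and co = smooth_at_coord[OF p]
    have sk: "smooth_at M p (?k i)" for i by (rule smooth_at_lincomb[OF co c p])
    have st: "smooth_at M p (?t i)" for i by (rule smooth_at_mult[OF sk sG p])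
    note su = tangent_sum[where f = ?t and I = UNIV, OF u p st]
    have sh: "smooth_at M p ?h" by (rule smooth_at_lincomb[OF conjunct1[OF su] c p])
    have "u f = u ?h"
    proof (rule tangent_germ[OF u p f sh open_preimage[OF open_ball]])
      show "p \<in> {x \<in> U. \<phi> x \<in> ?B}" using p r by simp
      show "f x = ?h x" if "x \<in> {x \<in> U. \<phi> x \<in> ?B}" for x
        using G(2)[of "\<phi> x"] that p by simp
    qed
    also have "\<dots> = (\<Sum>i\<in>UNIV. u (?t i))"
      using tangentD(1)[OF u conjunct1[OF su] c[of "f p"], where a = 1] conjunct2[OF su] tangent_const[OF u p] by simp
    also have "\<dots> = (\<Sum>i\<in>UNIV. u (\<lambda>x. \<phi> x $ i) * G i (\<phi> p))"
    proof (rule sum.cong)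
      fix i
      show "u (?t i) = u (\<lambda>x. \<phi> x $ i) * G i (\<phi> p)"
        using tangentD(2)[OF u sk[of i] sG[of i]] tangentD(1)[OF u co[of i] c[of "- (\<phi> p $ i)"], where a = 1] tangent_const[OF u p]
        by simp
    qed simp
    also have "\<dots> = frechet_derivative (\<lambda>y. f (\<psi> y)) (at (\<phi> p)) ?v"
    proof -
      let ?F = "frechet_derivative (\<lambda>y. f (\<psi> y)) (at (\<phi> p))"
      note l = has_derivative_linear[OF smooth_at_has_derivative[OF f p]]
      have "?F ?v = ?F (\<Sum>i\<in>UNIV. ?v $ i *\<^sub>R axis i 1)"
        by (simp only: basis_expansion scalar_mult_eq_scaleR[symmetric])
      also have "\<dots> = (\<Sum>i\<in>UNIV. ?v $ i * ?F (axis i 1))"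
        by (simp only: linear_sum[OF l] linear_cmul[OF l] real_scaleR_def)
      finally show ?thesis by (simp add: G(3))
    qed
    finally show ?thesis using f by (simp add: chart_deriv_def)
  qed
qed

end

subsection \<open>Bump functions and the area density\<close>

lemma smooth_fun_on_local:
  assumes M: "smooth_manifold M"
    and loc: "\<And>p. p \<in> W \<Longrightarrow> \<exists>W'. openin (topo M) W' \<and> p \<in> W' \<and> smooth_fun_on M W' f"
  shows "smooth_fun_on M W f"
  unfolding smooth_fun_on_def
proof clarify
  fix V \<theta> assume V: "(V, \<theta>) \<in> atlas M"
  interpret V: smooth_chart M V \<theta> by unfold_locales (rule M, rule V)
  show "smooth_on (\<theta> ` (V \<inter> W)) (f \<circ> V.\<psi>)"
  proof (rule smooth_on_local)
    fix y assume "y \<in> \<theta> ` (V \<inter> W)"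
    then obtain p where p: "p \<in> V" "p \<in> W" "y = \<theta> p" by auto
    from loc[OF p(2)] obtain W' where W': "openin (topo M) W'" "p \<in> W'" "smooth_fun_on M W' f" by blast
    have "smooth_on (\<theta> ` (V \<inter> W')) (f \<circ> V.\<psi>)" using W'(3) V by (auto simp: smooth_fun_on_def)
    then show "\<exists>T. open T \<and> y \<in> T \<and> smooth_on T (f \<circ> V.\<psi>)"
      using V.open_image[OF W'(1)] p W'(2) by blast
  qed
qed

lemma smooth_fun_on_zero:
  assumes M: "smooth_manifold M" and W: "openin (topo M) W" and z: "\<And>x. x \<in> W \<Longrightarrow> f x = 0"
  shows "smooth_fun_on M W f"
  unfolding smooth_fun_on_def
proof clarify
  fix V \<theta> assume V: "(V, \<theta>) \<in> atlas M"
  interpret V: smooth_chart M V \<theta> by unfold_locales (rule M, rule V)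
  show "smooth_on (\<theta> ` (V \<inter> W)) (f \<circ> V.\<psi>)"
    by (rule smooth_on_transform[OF smooth_on_const[of _ 0] V.open_image[OF W]]) (use z in auto)
qed

text \<open>\<open>flat_exp 0\<close> is \<open>exp (- 1/x)\<close> for positive arguments and 0
  otherwise; composed with \<open>r^2 - |y - a|^2\<close> it is smooth everywhere and, for positive
  \<open>r\<close>, positive exactly on the open ball.\<close>

definition bump :: "real ^ 'n \<Rightarrow> real \<Rightarrow> real ^ 'n::finite \<Rightarrow> real" where
  "bump a r y = flat_exp 0 (r\<^sup>2 - (y - a) \<bullet> (y - a))"

lemma smooth_on_bump: "smooth_on UNIV (bump a r)"
proof -
  have d: "smooth_on UNIV (\<lambda>y. y + - a)"
    by (intro smooth_on_add smooth_on_const smooth_on_linear[OF bounded_linear_ident] open_UNIV)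
  have "Ck_on k UNIV (\<lambda>y. (y + - a) \<bullet> (y + - a))" for k
    using d by (intro Ck_on_bounded_bilinear[OF bounded_bilinear_inner]) (auto simp: smooth_on_def)
  then have "smooth_on UNIV (\<lambda>y. (y + - a) \<bullet> (y + - a))" by (simp add: smooth_on_def)
  then have 1: "smooth_on UNIV (\<lambda>y. r\<^sup>2 + - 1 * ((y + - a) \<bullet> (y + - a)))"
    by (intro smooth_on_add smooth_on_mult smooth_on_const open_UNIV)
  have 2: "smooth_on UNIV (flat_exp 0)" by (simp add: smooth_on_def Ck_on_flat_exp)
  have "smooth_on UNIV (\<lambda>y. flat_exp 0 (r\<^sup>2 + - 1 * ((y + - a) \<bullet> (y + - a))))"
    by (rule smooth_on_compose[OF open_UNIV open_UNIV _ 2 1]) simp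
  then show ?thesis unfolding bump_def[abs_def] by simp
qed

lemma bump_pos:
  assumes "y \<in> ball a r"
  shows "bump a r y > 0"
proof -
  have "norm (y - a) < r" using assms by (simp add: dist_norm norm_minus_commute)
  then have "(norm (y - a))\<^sup>2 < r\<^sup>2" by (intro power_strict_mono) auto
  then show ?thesis by (simp add: bump_def flat_exp_def dot_square_norm)
qed

lemma bump_eq_0:
  assumes "y \<notin> ball a r" "r > 0"
  shows "bump a r y = 0"
proof -
  have "r \<le> norm (y - a)" using assms by (simp add: dist_norm norm_minus_commute)
  then have "r\<^sup>2 \<le> (norm (y - a))\<^sup>2" using assms by (intro power_mono) auto
  then show ?thesis by (simp add: bump_def flat_exp_def dot_square_norm)
qed

context smooth_chart begin

lemma compactin_preimage:
  assumes "compact K" "K \<subseteq> \<phi> ` U"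
  shows "compactin (topo M) (\<psi> ` K)"
proof -
  have "compactin (top_of_set (\<phi> ` U)) K" using assms by (simp add: compactin_subtopology)
  then show ?thesis by (rule image_compactin[OF _ continuous_\<psi>])
qed

definition bump_field :: "real ^ 'n \<Rightarrow> real \<Rightarrow> real ^ 'n \<Rightarrow> 'a \<Rightarrow> 'a tangent" where
  "bump_field a r v p = (if p \<in> U then bump a r (\<phi> p) *\<^sub>R chart_deriv p v else 0)"

text \<open>On the chart domain the field is a smooth multiple of a coordinate field; off the chart
  preimage of the closed ball it vanishes. These two sets cover the manifold, and the second is open
  because the preimage is compact, hence closed in a Hausdorff space.\<close>

lemma vector_field_bump_field:
  assumes r: "r > 0" and B: "cball a r \<subseteq> \<phi> ` U"
  shows "vector_field M (bump_field a r v)"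
  unfolding vector_field_def
proof (intro conjI ballI allI impI)
  fix p
  show "bump_field a r v p \<in> tangent_space M p"
    using subspace_tangent_space[of M p] chart_deriv_tangent[of p v]
    by (auto simp: bump_field_def subspace_scale subspace_0)
next
  fix W f assume W: "openin (topo M) W" and f: "smooth_fun_on M W f"
  show "smooth_fun_on M W (\<lambda>p. bump_field a r v p f)"
  proof (rule smooth_fun_on_local[OF manifold])
    fix p assume p: "p \<in> W"
    show "\<exists>W'. openin (topo M) W' \<and> p \<in> W' \<and> smooth_fun_on M W' (\<lambda>p. bump_field a r v p f)"
    proof (cases "p \<in> U")
      case True
      let ?W = "U \<inter> W"
      have oW: "openin (topo M) ?W" using W open_domain by (rule openin_Int[rotated])
      note op = open_image[OF W]
      have f': "smooth_on (\<phi> ` ?W) (\<lambda>y. f (\<psi> y))"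
        using f chart by (auto simp: smooth_fun_on_def o_def)
      have "smooth_on (\<phi> ` ?W) (\<lambda>y. bump a r y * frechet_derivative (\<lambda>y. f (\<psi> y)) (at y) v)"
        by (rule smooth_on_mult[OF op smooth_on_subset[OF smooth_on_bump subset_UNIV] smooth_on_frechet_derivative[OF f']])
      then have "smooth_on (\<phi> ` ?W) (\<lambda>y. bump_field a r v (\<psi> y) f)"
      proof (rule smooth_on_transform[OF _ op])
        fix y assume "y \<in> \<phi> ` ?W"
        then obtain x where x: "x \<in> U" "x \<in> W" "y = \<phi> x" by auto
        have "smooth_at M x f" using W f x unfolding smooth_at_def by blast
        then show "bump a r y * frechet_derivative (\<lambda>y. f (\<psi> y)) (at y) v = bump_field a r v (\<psi> y) f"
          using x by (simp add: bump_field_def chart_deriv_def)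
      qed
      then have "smooth_fun_on M ?W (\<lambda>p. bump_field a r v p f)"
        using smooth_fun_on_chart[OF oW] by blast
      then show ?thesis using oW p True by blast
    next
      case False
      let ?K = "\<psi> ` cball a r" and ?W = "pts M - \<psi> ` cball a r"
      have K: "closedin (topo M) ?K"
        using compactin_imp_closedin compactin_preimage[OF compact_cball B] manifold
        by (auto simp: smooth_manifold_def)
      have KU: "?K \<subseteq> U" using B \<psi>_in by auto
      have oW: "openin (topo M) ?W" using K by (simp add: openin_diff)
      moreover have "p \<in> ?W" using p W False KU openin_subset by blast
      moreover have "smooth_fun_on M ?W (\<lambda>p. bump_field a r v p f)"
      proof (rule smooth_fun_on_zero[OF manifold oW])
        fix x assume x: "x \<in> ?W"
        have "\<phi> x \<notin> ball a r" if "x \<in> U"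
        proof
          assume "\<phi> x \<in> ball a r"
          then have "\<psi> (\<phi> x) \<in> ?K" by (intro imageI) auto
          then show False using x that by simp
        qed
        then show "bump_field a r v x f = 0" using bump_eq_0[of "\<phi> x" a r] r by (auto simp: bump_field_def)
      qed
      ultimately show ?thesis by blast
    qed
  qed
qed

end

section \<open>The area density of a surface in a chart\<close>

locale two_riemannian_surface = smooth_chart M U \<phi> for M :: "('a, 2) manifold" and U \<phi> +
  fixes g :: "'a two_metric"
  assumes metric: "two_riemannian_metric M g"
begin

text \<open>The squared area of the coordinate parallelogram; its square root is the Jacobian
  determinant to be realised.\<close>

definition density :: "'a \<Rightarrow> real" where
  "density p = g p (chart_deriv p (axis 1 1)) (chart_deriv p (axis 1 1)) (chart_deriv p (axis 2 1))"

lemma metric_at: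
  assumes "p \<in> U"
  shows "two_inner_product_on (tangent_space M p) (g p)"
  using metric assms domain_subset by (auto simp: two_riemannian_metric_def)

lemma metric_density:
  assumes p: "p \<in> U"
  shows "g p (chart_deriv p u) (chart_deriv p v) (chart_deriv p w) = density p * (det2 u w * det2 v w)"
proof -
  have e: "chart_deriv p x = x $ 1 *\<^sub>R chart_deriv p (axis 1 1) + x $ 2 *\<^sub>R chart_deriv p (axis 2 1)" for x
    using chart_deriv_lincomb[OF p, of "x $ 1" "axis 1 1" "x $ 2" "axis 2 1"] vec2_eq_axis[of x] by simp
  show ?thesis
    unfolding e[of u] e[of v] e[of w] density_def det2_def
    by (rule two_inner_product_on_plane[OF subspace_tangent_space metric_at[OF p] chart_deriv_tangent[OF p] chart_deriv_tangent[OF p]])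
qed

lemma density_pos:
  assumes p: "p \<in> U"
  shows "density p > 0"
proof -
  let ?e1 = "chart_deriv p (axis 1 1)" and ?e2 = "chart_deriv p (axis 2 1)"
  have "\<not> lin_dep ?e1 ?e2"
  proof
    assume "lin_dep ?e1 ?e2"
    then obtain a b where ab: "a \<noteq> 0 \<or> b \<noteq> 0" "a *\<^sub>R ?e1 + b *\<^sub>R ?e2 = 0" by (auto simp: lin_dep_def)
    have "(a *\<^sub>R axis 1 1 + b *\<^sub>R axis 2 1 :: real ^ 2) $ i = 0" for i :: 2
      using chart_deriv_coord[OF p, of "a *\<^sub>R axis 1 1 + b *\<^sub>R axis 2 1" i]
      unfolding chart_deriv_lincomb[OF p] ab(2) by simp
    from this[of 1] this[of 2] ab(1) show False by (auto simp: axis_def)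
  qed
  moreover have "density p \<ge> 0" "density p = 0 \<longleftrightarrow> lin_dep ?e1 ?e2"
    using metric_at[OF p] chart_deriv_tangent[OF p] unfolding two_inner_product_on_def density_def by blast+
  ultimately show ?thesis by linarith
qed

text \<open>The cut-off coordinate fields are global because the closed ball lies in the chart
  range. The power of the bump that they introduce is removed by \<open>powr (-4)\<close>, which is
  smooth since the bump is positive on the open ball.\<close>

lemma smooth_density:
  assumes r: "r > 0" and B: "cball a r \<subseteq> \<phi> ` U"
  shows "smooth_on (ball a r) (\<lambda>y. density (\<psi> y))"
proof -
  let ?X = "bump_field a r (axis 1 1)" and ?Y = "bump_field a r (axis 2 1)"
  let ?f = "\<lambda>p. g p (?X p) (?X p) (?Y p)" and ?b = "bump a r"
  have BU: "ball a r \<subseteq> \<phi> ` U" using B ball_subset_cball by blast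
  have "smooth_fun_on M (pts M) ?f"
    using metric vector_field_bump_field[OF r B] by (auto simp: two_riemannian_metric_def)
  then have "smooth_on (\<phi> ` (U \<inter> pts M)) (\<lambda>y. ?f (\<psi> y))" using chart by (auto simp: smooth_fun_on_def o_def)
  then have f: "smooth_on (ball a r) (\<lambda>y. ?f (\<psi> y))"
    by (rule smooth_on_subset) (use BU domain_subset in \<open>simp add: Int_absorb2\<close>)
  have "smooth_on (ball a r) (\<lambda>y. ?b y powr (-4))"
    by (rule smooth_on_compose[OF open_ball open_greaterThan _ smooth_on_powr smooth_on_subset[OF smooth_on_bump subset_UNIV]])
      (auto simp: bump_pos)
  from smooth_on_mult[OF open_ball f this] show ?thesis
  proof (rule smooth_on_transform[OF _ open_ball])
    fix y assume y: "y \<in> ball a r"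
    then have yU: "y \<in> \<phi> ` U" using BU by blast
    let ?p = "\<psi> y"
    have p: "?p \<in> U" "\<phi> ?p = y" using \<psi>_in[OF yU] \<phi>_\<psi>[OF yU] by auto
    \<comment> \<open>The scalar is absorbed into the coordinate vector so that
      \<open>metric_density\<close> applies; each of its two determinants then contributes the
      square of the bump.\<close>
    have sc: "bump_field a r v ?p = chart_deriv ?p (?b y *\<^sub>R v)" for v
      using chart_deriv_lincomb[OF p(1), of "?b y" v 0 0] p by (simp add: bump_field_def)
    have "?f ?p = density ?p * (?b y) ^ 4"
      unfolding sc metric_density[OF p(1)] by (simp add: det2_def axis_def power4_eq_xxxx)
    moreover have "?b y ^ 4 * ?b y powr (-4) = 1"
      using bump_pos[OF y] by (simp add: powr_minus flip: powr_numeral)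
    ultimately show "?f ?p * ?b y powr (-4) = density ?p"
      by (simp only: mult.assoc mult_1_right)
  qed
qed

end

subsection \<open>The local 2-isometry\<close>

text \<open>The inverse is \<open>\<psi>\<close> after \<open>k\<close>. Both directions have to be
  tested against an arbitrary chart \<open>(V, \<theta>)\<close> of the atlas, and the transition
  map between \<open>\<theta>\<close> and \<open>\<phi>\<close> supplies the missing smooth
  factor.\<close>

lemma (in smooth_chart) diffeomorphism_chart_compose:
  fixes h :: "real ^ 'n \<Rightarrow> real ^ 'n"
  assumes B: "open B" "B \<subseteq> \<phi> ` U"
    and h: "smooth_on B h" and hB: "open (h ` B)" and k: "smooth_on (h ` B) k" and kh: "\<And>x. x \<in> B \<Longrightarrow> k (h x) = x"
  shows "diffeomorphism (open_submanifold M {x \<in> U. \<phi> x \<in> B})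
    (open_submanifold euclidean_manifold (h ` B)) (\<lambda>x. h (\<phi> x))"
proof -
  let ?W = "{x \<in> U. \<phi> x \<in> B}" and ?B' = "h ` B"
  let ?M = "open_submanifold M ?W" and ?N = "open_submanifold (euclidean_manifold :: (real ^ 'n, 'n) manifold) ?B'"
  have oW: "openin (topo M) ?W" by (rule open_preimage[OF B(1)])
  have \<phi>W: "\<phi> ` ?W = B" using B(2) by auto
  have topo: "topo ?M = subtopology (topo M) ?W" "topo ?N = top_of_set ?B'"
    by (simp_all add: open_submanifold_def euclidean_manifold_def)
  have WM: "pts ?M = ?W" "pts ?N = ?B'"
    using openin_subset[OF oW] by (auto simp: topo)
  have contH: "continuous_map (topo ?M) (topo ?N) (\<lambda>x. h (\<phi> x))"
  proof -
    have "continuous_map (subtopology (topo M) U) euclidean \<phi>"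
      using homeomorphic_imp_continuous_map[OF homeomorphic] by (simp add: continuous_map_in_subtopology)
    then have "continuous_map (subtopology (topo M) ?W) euclidean \<phi>"
      by (rule continuous_map_from_subtopology_mono) auto
    then have "continuous_map (subtopology (topo M) ?W) (top_of_set B) \<phi>"
      by (auto simp: continuous_map_in_subtopology)
    moreover have "continuous_map (top_of_set B) (top_of_set ?B') h"
      using smooth_on_imp_continuous_on[OF h] by (auto simp: continuous_map_in_subtopology)
    ultimately have "continuous_map (subtopology (topo M) ?W) (top_of_set ?B') (h \<circ> \<phi>)"
      by (rule continuous_map_compose)
    then show ?thesis unfolding topo by (simp add: o_def)
  qed
  have kB: "k ` ?B' = B" using kh by (auto simp: image_iff)
  have contK: "continuous_map (topo ?N) (topo ?M) (\<lambda>y. \<psi> (k y))"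
  proof -
    have "continuous_map (top_of_set ?B') (top_of_set (\<phi> ` U)) k"
      using smooth_on_imp_continuous_on[OF k] kB B(2) by (auto simp: continuous_map_in_subtopology)
    then have "continuous_map (top_of_set ?B') (topo M) (\<psi> \<circ> k)"
      by (rule continuous_map_compose[OF _ continuous_\<psi>])
    moreover have "\<psi> (k y) \<in> ?W" if "y \<in> ?B'" for y
    proof -
      have "k y \<in> B" using kB that by blast
      then show ?thesis using B(2) \<psi>_in \<phi>_\<psi> by (metis (mono_tags, lifting) mem_Collect_eq subsetD)
    qed
    ultimately show ?thesis
      unfolding topo by (auto simp: continuous_map_in_subtopology o_def)
  qed
  have atl: "atlas ?M = (\<lambda>(V, \<theta>). (V \<inter> ?W, \<theta>)) ` atlas M" "atlas ?N = {(?B', id)}"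
    by (simp_all add: open_submanifold_def euclidean_manifold_def)
  have idi: "inv_into ?B' id y = y" if "y \<in> ?B'" for y
    using inv_into_f_f[of id ?B' y] that by simp
  have smH: "smooth_on (\<theta> ` (V \<inter> ?W \<inter> (\<lambda>x. h (\<phi> x)) -` ?B')) (id \<circ> (\<lambda>x. h (\<phi> x)) \<circ> inv_into (V \<inter> ?W) \<theta>)"
    if V: "(V, \<theta>) \<in> atlas M" for V \<theta>
  proof -
    interpret V: smooth_chart M V \<theta> by unfold_locales (rule manifold, rule V)
    have e: "V \<inter> ?W \<inter> (\<lambda>x. h (\<phi> x)) -` ?B' = V \<inter> ?W" by auto
    note op = V.open_image[OF oW]
    have 1: "smooth_on (\<theta> ` (V \<inter> ?W)) (\<lambda>y. \<phi> (V.\<psi> y))"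
      by (rule smooth_on_subset[OF V.transition[OF chart]]) auto
    have "smooth_on (\<theta> ` (V \<inter> ?W)) (\<lambda>y. h (\<phi> (V.\<psi> y)))"
      by (rule smooth_on_compose[OF op B(1) _ h 1]) auto
    then show ?thesis unfolding e
    proof (rule smooth_on_transform[OF _ op])
      fix y assume "y \<in> \<theta> ` (V \<inter> ?W)"
      then obtain x where x: "x \<in> V \<inter> ?W" "y = \<theta> x" by auto
      have "inv_into (V \<inter> ?W) \<theta> y = x"
        using inv_into_f_f[OF inj_on_subset[OF V.inj] x(1)] x(2) by simp
      then show "h (\<phi> (V.\<psi> y)) = (id \<circ> (\<lambda>x. h (\<phi> x)) \<circ> inv_into (V \<inter> ?W) \<theta>) y"
        using x by simp
    qed
  qed
  have smK: "smooth_on (id ` (?B' \<inter> (\<lambda>y. \<psi> (k y)) -` (V \<inter> ?W))) (\<theta> \<circ> (\<lambda>y. \<psi> (k y)) \<circ> inv_into ?B' id)"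
    if V: "(V, \<theta>) \<in> atlas M" for V \<theta>
  proof -
    let ?T = "\<phi> ` (U \<inter> (V \<inter> ?W))"
    interpret V: smooth_chart M V \<theta> by unfold_locales (rule manifold, rule V)
    have oT: "open ?T" by (intro open_image openin_Int V.open_domain oW)
    \<comment> \<open>Written as a preimage under \<open>k\<close> alone, the set is visibly open:
      \<open>k\<close> is continuous on the open image of \<open>B\<close>, and \<open>?T\<close> is
      open.\<close>
    have e: "id ` (?B' \<inter> (\<lambda>y. \<psi> (k y)) -` (V \<inter> ?W)) = ?B' \<inter> k -` ?T"
    proof -
      have "\<psi> (k y) \<in> V \<inter> ?W \<longleftrightarrow> k y \<in> ?T" if "y \<in> ?B'" for y
      proof -
        have "k y \<in> \<phi> ` U" using kB B(2) that by blast
        then obtain x where "x \<in> U" "k y = \<phi> x" by auto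
        then show ?thesis using inj by (auto dest: inj_onD)
      qed
      then show ?thesis by auto
    qed
    have op: "open (?B' \<inter> k -` ?T)"
      by (rule continuous_open_preimage[OF smooth_on_imp_continuous_on[OF k] hB oT])
    have t: "smooth_on ?T (\<lambda>y. \<theta> (\<psi> y))"
      by (rule smooth_on_subset[OF transition[OF V]]) auto
    have "smooth_on (?B' \<inter> k -` ?T) (\<lambda>y. \<theta> (\<psi> (k y)))"
      by (rule smooth_on_compose[OF op oT _ t smooth_on_subset[OF k]]) auto
    then show ?thesis unfolding e
      by (rule smooth_on_transform[OF _ op]) (auto simp: idi)
  qed
  have "smooth_map ?M ?N (\<lambda>x. h (\<phi> x))"
    unfolding smooth_map_def using contH smH by (auto simp: atl)
  moreover have "smooth_map ?N ?M (\<lambda>y. \<psi> (k y))"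
    unfolding smooth_map_def using contK smK by (auto simp: atl)
  moreover have "\<forall>p\<in>pts ?M. \<psi> (k (h (\<phi> p))) = p" "\<forall>q\<in>pts ?N. h (\<phi> (\<psi> (k q))) = q"
    using kh B(2) \<phi>_\<psi> by (auto simp: WM subset_iff)
  ultimately show ?thesis unfolding diffeomorphism_def by blast
qed

text \<open>Lagrange's identity in the plane; it puts the standard metric into the determinant form
  of \<open>metric_density\<close>, so that the two can be compared.\<close>

lemma g_st_eq_det2:
  "g_st p u v w = det2 (tangent_vec u) (tangent_vec w) * det2 (tangent_vec v) (tangent_vec w)"
  by (simp add: g_st_def Let_def det2_def inner_vec_def sum_2 algebra_simps)

text \<open>\<open>tangent_vec\<close> reads off values on the coordinate functions, so this is the
  chain rule taken componentwise in the chart.\<close>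

lemma (in smooth_chart) tangent_vec_differential:
  fixes h :: "real ^ 'n \<Rightarrow> real ^ 'm::finite"
  assumes p: "p \<in> U" and h: "smooth_on B h" and B: "open B" "\<phi> p \<in> B" "open B'" "h (\<phi> p) \<in> B'"
  shows "tangent_vec (differential N (open_submanifold euclidean_manifold B') (\<lambda>x. h (\<phi> x)) p (chart_deriv p v)) =
    frechet_derivative h (at (\<phi> p)) v"
proof -
  let ?E = "euclidean_manifold :: (real ^ 'm, 'm) manifold"
  have "tangent_vec (differential N (open_submanifold ?E B') (\<lambda>x. h (\<phi> x)) p (chart_deriv p v)) $ i =
      frechet_derivative h (at (\<phi> p)) v $ i" for i
  proof -
    note L = bounded_linear_vec_nth[of i]
    \<comment> \<open>Were the coordinate function not smooth on the target,
      \<open>differential\<close> would return its default 0.\<close>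
    have "smooth_fun_on (open_submanifold ?E B') B' (\<lambda>x. x $ i)"
    proof -
      have "smooth_on B' ((\<lambda>x. x $ i) \<circ> inv_into B' id)"
        by (rule smooth_on_transform[OF smooth_on_linear[OF L B(3)] B(3)])
          (use inv_into_f_f[of id B'] in auto)
      then show ?thesis by (simp add: smooth_fun_on_def open_submanifold_def euclidean_manifold_def)
    qed
    moreover have "openin (topo (open_submanifold ?E B')) B'"
      by (simp add: open_submanifold_def euclidean_manifold_def)
    ultimately have "smooth_at (open_submanifold ?E B') (h (\<phi> p)) (\<lambda>x. x $ i)"
      using B(4) unfolding smooth_at_def by blast
    then have "tangent_vec (differential N (open_submanifold ?E B') (\<lambda>x. h (\<phi> x)) p (chart_deriv p v)) $ i =
        chart_deriv p v (\<lambda>x. h (\<phi> x) $ i)"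
      by (simp add: tangent_vec_def differential_def o_def)
    also have "\<dots> = frechet_derivative h (at (\<phi> p)) v $ i"
    proof (rule chart_deriv_eq)
      show "smooth_at M p (\<lambda>x. h (\<phi> x) $ i)"
        by (rule smooth_atI[OF p B(1,2) smooth_on_bounded_linear[OF L B(1) h]]) simp
      have "((\<lambda>y. h y $ i) has_derivative (\<lambda>v. frechet_derivative h (at (\<phi> p)) v $ i)) (at (\<phi> p))"
        by (rule bounded_linear.has_derivative[OF L smooth_on_has_derivative[OF h B(2)]])
      then show "((\<lambda>y. h (\<phi> (\<psi> y)) $ i) has_derivative (\<lambda>v. frechet_derivative h (at (\<phi> p)) v $ i)) (at (\<phi> p))"
        by (rule has_derivative_transform_within_open[OF _ open_range]) (use p \<phi>_\<psi> in auto)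
    qed
    finally show ?thesis .
  qed
  then show ?thesis by (simp add: vec_eq_iff)
qed

theorem theorem2p4:
  fixes M :: "('a, 2) manifold" and g :: "'a two_metric"
  assumes "two_riemannian_manifold M g"
  shows "locally_flat M g"
  unfolding locally_flat_def locally_two_isometric_def
proof
  fix p assume p: "p \<in> pts M"
  have M: "smooth_manifold M" and g: "two_riemannian_metric M g"
    using assms by (auto simp: two_riemannian_manifold_def)
  obtain U \<phi> where c: "(U, \<phi>) \<in> atlas M" and pU: "p \<in> U"
  proof -
    have "p \<in> (\<Union>(U, \<phi>)\<in>atlas M. U)" using M p by (simp add: smooth_manifold_def)
    then show thesis by (auto intro: that)
  qed
  interpret two_riemannian_surface M U \<phi> g
    by unfold_locales (rule M, rule c, rule g)
  obtain r where r: "r > 0" "cball (\<phi> p) r \<subseteq> \<phi> ` U"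
    using open_contains_cball open_range pU by (metis imageI)
  let ?B = "ball (\<phi> p) r"
  let ?W = "{x \<in> U. \<phi> x \<in> ?B}"
  have BU: "?B \<subseteq> \<phi> ` U" using r(2) ball_subset_cball by blast
  let ?s = "\<lambda>y. density (\<psi> y) powr (1/2)"
  have pos: "density (\<psi> y) > 0" if "y \<in> ?B" for y using density_pos \<psi>_in BU that by blast
  have s: "smooth_on ?B ?s"
    by (rule smooth_on_compose[OF open_ball open_greaterThan _ smooth_on_powr smooth_density[OF r]])
      (use pos in auto)
  have spos: "?s y > 0" if "y \<in> ?B" for y using pos[OF that] by simp
  obtain h k where h: "smooth_on ?B h" "open (h ` ?B)" "smooth_on (h ` ?B) k"
    "\<And>x. x \<in> ?B \<Longrightarrow> k (h x) = x"
    "\<And>x v w. x \<in> ?B \<Longrightarrow> det2 (frechet_derivative h (at x) v) (frechet_derivative h (at x) w) = ?s x * det2 v w"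
    using prescribed_jacobian_diffeomorphism[OF s spos] by blast
  let ?M = "open_submanifold M ?W" and ?N = "open_submanifold (euclidean_manifold :: (real ^ 2, 2) manifold) (h ` ?B)"
  let ?H = "\<lambda>x. h (\<phi> x)"
  have W: "openin (topo M) ?W" by (rule open_preimage[OF open_ball])
  have "two_isometry ?M g ?N g_st ?H"
    unfolding two_isometry_def
  proof (intro conjI ballI)
    show "diffeomorphism ?M ?N ?H"
      by (rule diffeomorphism_chart_compose[OF open_ball BU h(1-4)])
    fix q u v w
    assume "q \<in> pts ?M"
    then have q: "q \<in> ?W" by (simp add: open_submanifold_def)
    assume "u \<in> tangent_space ?M q" "v \<in> tangent_space ?M q" "w \<in> tangent_space ?M q"
    then have "u \<in> tangent_space M q" "v \<in> tangent_space M q" "w \<in> tangent_space M q"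
      by (simp_all only: tangent_space_open_submanifold[OF M W q])
    then obtain u' v' w' where uvw: "u = chart_deriv q u'" "v = chart_deriv q v'" "w = chart_deriv q w'"
      using tangent_eq_chart_deriv q by blast
    have qB: "q \<in> U" "\<phi> q \<in> ?B" using q by auto
    have tv: "tangent_vec (differential ?M ?N ?H q (chart_deriv q x)) = frechet_derivative h (at (\<phi> q)) x" for x
      by (rule tangent_vec_differential[OF qB(1) h(1) open_ball qB(2) h(2) imageI[OF qB(2)]])
    \<comment> \<open>Each of the two determinants in \<open>g_st\<close> contributes one factor
      \<open>?s\<close>, and their product restores the density.\<close>
    have "g_st (?H q) (differential ?M ?N ?H q u) (differential ?M ?N ?H q v) (differential ?M ?N ?H q w) =
        (?s (\<phi> q) * ?s (\<phi> q)) * (det2 u' w' * det2 v' w')"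
      unfolding g_st_eq_det2 uvw tv h(5)[OF qB(2)] by (simp only: ac_simps)
    also have "?s (\<phi> q) * ?s (\<phi> q) = density q"
      using density_pos[OF qB(1)] qB by (simp flip: powr_add)
    finally show "g_st (?H q) (differential ?M ?N ?H q u) (differential ?M ?N ?H q v) (differential ?M ?N ?H q w) = g q u v w"
      unfolding uvw metric_density[OF qB(1)] .
  qed
  moreover have "p \<in> ?W" using pU r(1) by simp
  moreover have "openin (topo euclidean_manifold) (h ` ?B)" using h(2) by (simp add: euclidean_manifold_def)
  ultimately show "\<exists>U U' h. openin (topo M) U \<and> p \<in> U \<and> openin (topo (euclidean_manifold :: (real ^ 2, 2) manifold)) U' \<and>
      two_isometry (open_submanifold M U) g (open_submanifold euclidean_manifold U') g_st h"
    using W by blast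
qed

end
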